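(* Let $D$ be a $\mathbb{C}$-derivation of the polynomial ring $B=\mathbb{C}[x_1,x_2]$. Then there exist $y_1,y_2\in B$ with $B=\mathbb{C}[y_1,y_2]$ such that $D=\partial/\partial y_1$ (the partial derivative with respect to the system of variables $\{y_1,y_2\}$) if and only if $D$ is surjective and $\operatorname{Ker} D \supsetneqq \mathbb{C}$.
   Context: A $\mathbb{C}$-derivation $D$ of a $\mathbb{C}$-algebra $B$ is a $\mathbb{C}$-linear map $D:B\to B$ satisfying the Leibniz rule; it is surjective if it is surjective as a map $B\to B$. *)

theory Defs
  imports Complex_Main "HOL-Computational_Algebra.Polynomial"
begin

text \<open>
  The ring \<open>\<complex>[x\<^sub>1, x\<^sub>2]\<close> is represented as \<open>\<complex>[x\<^sub>1][x\<^sub>2]\<close>: the inner variable is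
  \<open>x\<^sub>1\<close>, the outer one \<open>x\<^sub>2\<close>.
\<close>

type_synonym cpoly2 = "complex poly poly"

definition const2 :: "complex \<Rightarrow> cpoly2" where
  "const2 c = [:[:c:]:]"

definition X1 :: cpoly2 where "X1 = [:[:0, 1:]:]"

definition X2 :: cpoly2 where "X2 = [:0, 1:]"

definition scale2 :: "complex \<Rightarrow> cpoly2 \<Rightarrow> cpoly2" where
  "scale2 c f = const2 c * f"

definition derivation2 :: "(cpoly2 \<Rightarrow> cpoly2) \<Rightarrow> bool" where
  "derivation2 D \<longleftrightarrow>
     Vector_Spaces.linear scale2 scale2 D \<and> (\<forall>f g. D (f * g) = f * D g + D f * g)"

text \<open>\<open>subst2 y1 y2 P\<close> is \<open>P(y\<^sub>1, y\<^sub>2)\<close>.\<close>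

definition subst2 :: "cpoly2 \<Rightarrow> cpoly2 \<Rightarrow> cpoly2 \<Rightarrow> cpoly2" where
  "subst2 y1 y2 P = poly (map_poly (\<lambda>q. poly (map_poly const2 q) y1) P) y2"

text \<open>The subalgebra \<open>\<complex>[y\<^sub>1, y\<^sub>2]\<close>.\<close>

definition adjoin2 :: "cpoly2 \<Rightarrow> cpoly2 \<Rightarrow> cpoly2 set" where
  "adjoin2 y1 y2 = range (subst2 y1 y2)"

definition partial_X1 :: "cpoly2 \<Rightarrow> cpoly2" where
  "partial_X1 = map_poly pderiv"

text \<open>
  \<open>\<partial>/\<partial>y\<^sub>1\<close> with respect to the pair \<open>(y\<^sub>1, y\<^sub>2)\<close>: write \<open>f = P(y\<^sub>1, y\<^sub>2)\<close> and take
  \<open>(\<partial>P/\<partial>X\<^sub>1)(y\<^sub>1, y\<^sub>2)\<close>. This is only meaningful if \<open>P\<close> exists and is unique. Both hold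
  when \<open>\<complex>[y\<^sub>1, y\<^sub>2]\<close> is the whole ring, since two generators of a polynomial ring in two
  variables over a field are algebraically independent.
\<close>

definition partial1 :: "cpoly2 \<Rightarrow> cpoly2 \<Rightarrow> cpoly2 \<Rightarrow> cpoly2" where
  "partial1 y1 y2 f = subst2 y1 y2 (partial_X1 (THE P. subst2 y1 y2 P = f))"

definition ker2 :: "(cpoly2 \<Rightarrow> cpoly2) \<Rightarrow> cpoly2 set" where
  "ker2 D = {f. D f = 0}"

lemma const2_hom:
  "const2 0 = 0" "const2 1 = 1"
  "const2 (a + b) = const2 a + const2 b" "const2 (a * b) = const2 a * const2 b"
  by (simp_all add: const2_def one_pCons)

lemma vector_space_scale2: "vector_space scale2"
  by unfold_locales (simp_all add: scale2_def const2_hom algebra_simps)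

lemma derivation2_iff:
  "derivation2 D \<longleftrightarrow>
     (\<forall>f g. D (f + g) = D f + D g) \<and> (\<forall>c f. D (const2 c * f) = const2 c * D f) \<and>
     (\<forall>f g. D (f * g) = f * D g + D f * g)"
  using vector_space_scale2
  by (auto simp: derivation2_def Vector_Spaces.linear_iff scale2_def)

lemma subst2_generators:
  "subst2 y1 y2 (const2 c) = const2 c" "subst2 y1 y2 X1 = y1" "subst2 y1 y2 X2 = y2"
  by (simp_all add: subst2_def const2_def X1_def X2_def map_poly_pCons flip: one_pCons)

lemma partial_X1_generators:
  "partial_X1 (const2 c) = 0" "partial_X1 X1 = 1" "partial_X1 X2 = 0"
  by (simp_all add: partial_X1_def const2_def X1_def X2_def map_poly_pCons pderiv_pCons one_pCons)

end

theory Submission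
  imports
    Defs
    "HOL-Complex_Analysis.Complex_Analysis"
    "HOL-Computational_Algebra.Fraction_Field"
    "HOL-Computational_Algebra.Fundamental_Theorem_Algebra"
    "HOL-Computational_Algebra.Polynomial_Factorial"
    "HOL-Computational_Algebra.Field_as_Ring"
begin

text \<open>
  Write \<open>B = \<complex>[x\<^sub>1, x\<^sub>2]\<close>. If \<open>D = \<partial>/\<partial>y\<^sub>1\<close>, then \<open>D\<close> is surjective because polynomials can be
  integrated in characteristic 0, and its kernel contains \<open>y\<^sub>2\<close>. The only subtle point is that
  two generators of \<open>B\<close> are algebraically independent; the Jacobian criterion gives this
  (\<open>subst2_inj_if_generates\<close>).

  Conversely, let \<open>D\<close> be surjective, \<open>D s = 1\<close> and \<open>D f = 0\<close> with \<open>f\<close> not constant. Then \<open>f\<close>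
  and \<open>s\<close> are algebraically independent, \<open>D\<close> acts on \<open>A = \<complex>[f, s]\<close> as \<open>\<partial>/\<partial>s\<close>, and \<open>B\<close> is
  algebraic over \<open>A\<close>. The heart of the matter is that \<open>D\<close> is locally nilpotent. Let \<open>Tr\<close> be the
  trace from \<open>Frac B\<close> to \<open>\<complex>(f, s)\<close>; it commutes with the derivations. Since every \<open>g \<in> B\<close> is
  \<open>D h\<close> for some \<open>h\<close>, all multiples \<open>u Tr g = Tr (u g)\<close> with \<open>u \<in> A\<close> are \<open>s\<close>-derivatives of
  rational functions and thus have no residues. A rational function with a pole has a multiple with
  a simple pole and nonzero residue, so \<open>Tr g\<close> is a polynomial in \<open>s\<close> over \<open>K = \<complex>(f)\<close>
  (\<open>denominator_free_if_multiples_derivatives\<close>). The trace form is nondegenerate and therefore embeds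
  the localization of \<open>B\<close> at \<open>\<complex>[f] - {0}\<close> into a finite free \<open>K[s]\<close>-module. By noetherianity some \<open>D\<^sup>N g\<close> is a
  \<open>K[s]\<close>-combination of the lower iterates: \<open>g\<close> satisfies a linear differential equation
  that is monic up to an element of \<open>\<complex>[f]\<close> (\<open>monic_differential_equation\<close>).

  Now expand \<open>g\<close> along the trajectory of the vector field \<open>D\<close> through a point \<open>p\<close> of \<open>\<complex>\<^sup>2\<close>. For
  \<open>p\<close> outside finitely many fibres of \<open>f\<close> the Taylor series solves a linear equation without
  singularities, so it is entire; it is also algebraic over the polynomials in time, hence of
  polynomial growth. By Liouville it is a polynomial, of a degree bounded independently of \<open>p\<close>.
  Thus \<open>D\<^sup>n g\<close> vanishes on a dense set for large \<open>n\<close>, and \<open>D\<^sup>n g = 0\<close>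
  (\<open>locally_nilpotent_if_surj\<close>).

  A locally nilpotent derivation with a slice satisfies \<open>B = (Ker D)[s]\<close>, by repeated integration.
  Finally \<open>Ker D = \<complex>[y]\<close> for a nonconstant kernel element \<open>y\<close> of least size
  (\<open>kernel_generator\<close>): the kernel is factorially closed, so \<open>y\<close> is prime in \<open>B\<close>; an algebraic
  relation between \<open>y\<close> and any kernel element \<open>h\<close> shows that \<open>y\<close> divides some \<open>h - b\<close> with
  \<open>b \<in> \<complex>\<close>, and the quotient is a smaller kernel element. So \<open>(s, y)\<close> is the required pair.
\<close>

section \<open>Ring morphisms and derivations\<close>

locale ring_morphism =
  fixes h :: "'a::comm_ring_1 \<Rightarrow> 'b::comm_ring_1"
  assumes one: "h 1 = 1"
    and add: "h (a + b) = h a + h b"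
    and mult: "h (a * b) = h a * h b"
begin

lemma zero: "h 0 = 0"
  using add[of 0 0] by simp

lemma minus: "h (- a) = - h a"
  using add[of a "- a"] by (simp add: zero eq_neg_iff_add_eq_0 add.commute)

lemma diff: "h (a - b) = h a - h b"
  using add[of a "- b"] by (simp add: minus)

lemma sum: "h (\<Sum>i\<in>I. f i) = (\<Sum>i\<in>I. h (f i))"
  by (induction I rule: infinite_finite_induct) (simp_all add: zero add)

lemma power: "h (a ^ n) = h a ^ n"
  by (induction n) (simp_all add: one mult)

lemma poly_map_poly_pCons: "poly (map_poly h (pCons a p)) y = h a + y * poly (map_poly h p) y"
  by (simp add: map_poly_pCons zero)

lemma ring_morphism_poly: "ring_morphism (\<lambda>p. poly (map_poly h p) y)"
proof
  show "poly (map_poly h 1) y = 1" by (simp add: one)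
  have add': "poly (map_poly h (p + q)) y = poly (map_poly h p) y + poly (map_poly h q) y" for p q
    by (induction p q rule: poly_induct2)
      (simp_all only: poly_map_poly_pCons add_pCons add algebra_simps map_poly_0 poly_0 add_0)
  then show "poly (map_poly h (p + q)) y = poly (map_poly h p) y + poly (map_poly h q) y" for p q .
  have smult': "poly (map_poly h (smult a q)) y = h a * poly (map_poly h q) y" for a q
    by (induction q) (simp_all add: poly_map_poly_pCons mult algebra_simps del: map_poly_pCons)
  show "poly (map_poly h (p * q)) y = poly (map_poly h p) y * poly (map_poly h q) y" for p q
    by (induction p)
      (simp_all add: poly_map_poly_pCons add' smult' zero algebra_simps del: map_poly_pCons)
qed

lemma poly_map_poly_altdef:
  assumes "degree p \<le> n"
  shows "poly (map_poly h p) y = (\<Sum>i\<le>n. h (coeff p i) * y ^ i)"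
proof -
  interpret e: ring_morphism "\<lambda>p. poly (map_poly h p) y" by (rule ring_morphism_poly)
  have "poly (map_poly h p) y = poly (map_poly h (\<Sum>i\<le>n. monom (coeff p i) i)) y"
    using assms by (simp add: poly_as_sum_of_monoms')
  then show ?thesis
    by (simp add: e.sum map_poly_monom zero poly_monom)
qed

end

locale derivation =
  fixes d :: "'a::comm_ring_1 \<Rightarrow> 'a"
  assumes add: "d (a + b) = d a + d b"
    and mult: "d (a * b) = a * d b + d a * b"
begin

lemma zero: "d 0 = 0"
  using add[of 0 0] by simp

lemma one: "d 1 = 0"
  using mult[of 1 1] by simp

lemma minus: "d (- a) = - d a"
  using add[of a "- a"] by (simp add: zero eq_neg_iff_add_eq_0 add.commute)

lemma diff: "d (a - b) = d a - d b"
  using add[of a "- b"] by (simp add: minus)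

lemma sum: "d (\<Sum>i\<in>I. f i) = (\<Sum>i\<in>I. d (f i))"
  by (induction I rule: infinite_finite_induct) (simp_all add: zero add)

end

section \<open>Polynomials in two variables\<close>

text \<open>
  \<open>\<complex>[x\<^sub>1, x\<^sub>2]\<close> is generated by the constants and the variables, so an identity that is compatible
  with sums and products needs to be checked on these only.
\<close>
lemma cpoly2_induct [case_names const X1 X2 add mult]:
  fixes f :: cpoly2
  assumes const: "\<And>c. P (const2 c)" and X1: "P X1" and X2: "P X2"
    and add: "\<And>f g. P f \<Longrightarrow> P g \<Longrightarrow> P (f + g)" and mult: "\<And>f g. P f \<Longrightarrow> P g \<Longrightarrow> P (f * g)"
  shows "P f"
proof (induction f)
  case 0
  then show ?case using const[of 0] by (simp add: const2_hom)
next
  case (pCons a f)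
  have "P [:a:]"
  proof (induction a)
    case 0
    then show ?case using const[of 0] by (simp add: const2_hom)
  next
    case (pCons c a)
    have "[:pCons c a:] = const2 c + X1 * [:a:]"
      by (simp add: const2_def X1_def)
    then show ?case using add[OF const mult[OF X1 pCons.IH]] by metis
  qed
  moreover have "pCons a f = [:a:] + X2 * f"
    by (simp add: X2_def)
  ultimately show ?case using add mult X2 pCons.IH by metis
qed

lemma ring_morphism_const2: "ring_morphism const2"
  by unfold_locales (simp_all add: const2_hom)

lemma ring_morphism_subst2: "ring_morphism (subst2 y1 y2)"
proof -
  interpret c: ring_morphism const2 by (rule ring_morphism_const2)
  interpret i: ring_morphism "\<lambda>q. poly (map_poly const2 q) y1" by (rule c.ring_morphism_poly)
  show ?thesis using i.ring_morphism_poly[of y2] unfolding subst2_def .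
qed

lemma derivation2_derivation:
  assumes "derivation2 D"
  shows "derivation D"
  using assms by unfold_locales (auto simp: derivation2_iff)

lemma derivation2_const2:
  assumes "derivation2 D"
  shows "D (const2 c) = 0"
proof -
  interpret derivation D by (rule derivation2_derivation[OF assms])
  have "D (const2 c * 1) = const2 c * D 1"
    using assms unfolding derivation2_iff by blast
  then show ?thesis by (simp add: one)
qed

lemma derivation2I:
  assumes "derivation D" and "\<And>c. D (const2 c) = 0"
  shows "derivation2 D"
proof -
  interpret derivation D by fact
  show ?thesis by (simp add: derivation2_iff add mult assms(2))
qed

lemma derivation2_partial_X1: "derivation2 partial_X1"
proof (rule derivation2I)
  interpret p: derivation "pderiv :: complex poly \<Rightarrow> complex poly"
    by unfold_locales (simp_all add: pderiv_add pderiv_mult algebra_simps)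
  have add: "partial_X1 (f + g) = partial_X1 f + partial_X1 g" for f g
    by (intro poly_eqI) (simp add: partial_X1_def coeff_map_poly pderiv_add)
  show "derivation partial_X1"
  proof
    fix f g
    show "partial_X1 (f * g) = f * partial_X1 g + partial_X1 f * g"
      by (rule poly_eqI)
        (simp add: partial_X1_def coeff_map_poly coeff_mult p.sum p.mult sum.distrib)
  qed (rule add)
qed (simp add: partial_X1_generators)

lemma derivation2_pderiv: "derivation2 (pderiv :: cpoly2 \<Rightarrow> cpoly2)"
proof (rule derivation2I)
  show "derivation (pderiv :: cpoly2 \<Rightarrow> cpoly2)"
    by unfold_locales (simp_all add: pderiv_add pderiv_mult algebra_simps)
qed (simp add: const2_def pderiv_pCons)

text \<open>The chain rule.\<close>
lemma derivation2_subst2: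
  assumes "derivation2 D"
  shows "D (subst2 y1 y2 P) = subst2 y1 y2 (partial_X1 P) * D y1 + subst2 y1 y2 (pderiv P) * D y2"
proof -
  interpret D: derivation D by (rule derivation2_derivation[OF assms])
  interpret d1: derivation partial_X1 by (rule derivation2_derivation[OF derivation2_partial_X1])
  interpret d2: derivation "pderiv :: cpoly2 \<Rightarrow> cpoly2"
    by (rule derivation2_derivation[OF derivation2_pderiv])
  interpret s: ring_morphism "subst2 y1 y2" by (rule ring_morphism_subst2)
  show ?thesis
  proof (induction P rule: cpoly2_induct)
    case (const c)
    then show ?case
      by (simp add: subst2_generators derivation2_const2[OF assms] derivation2_const2[OF derivation2_pderiv]
          partial_X1_generators s.zero)
  next
    case X1
    have "pderiv X1 = (0::cpoly2)" by (simp add: X1_def pderiv_pCons)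
    then show ?case by (simp add: subst2_generators partial_X1_generators s.zero s.one)
  next
    case X2
    have "pderiv X2 = (1::cpoly2)" by (simp add: X2_def pderiv_pCons)
    then show ?case by (simp add: subst2_generators partial_X1_generators s.zero s.one)
  qed (simp_all add: s.add s.mult D.add D.mult d1.add d1.mult d2.add d2.mult algebra_simps)
qed

section \<open>Partial derivatives are surjective with nontrivial kernel\<close>

text \<open>
  The chain rule, applied to expressions of \<open>x\<^sub>1\<close> and \<open>x\<^sub>2\<close> through \<open>y\<^sub>1\<close> and \<open>y\<^sub>2\<close>, inverts the
  Jacobian matrix of \<open>(y\<^sub>1, y\<^sub>2)\<close>. Applied to a relation \<open>P(y\<^sub>1, y\<^sub>2) = 0\<close> it then says that both
  partial derivatives of \<open>P\<close> are relations as well; these have smaller degree, and in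
  characteristic 0 the descent ends with a constant relation.
\<close>
lemma subst2_inj_if_generates:
  assumes "adjoin2 y1 y2 = UNIV"
  shows "inj (subst2 y1 y2)"
proof -
  define \<sigma> where "\<sigma> = subst2 y1 y2"
  interpret s: ring_morphism \<sigma> unfolding \<sigma>_def by (rule ring_morphism_subst2)
  have chain: "D (\<sigma> P) = \<sigma> (partial_X1 P) * D y1 + \<sigma> (pderiv P) * D y2" if "derivation2 D" for D P
    unfolding \<sigma>_def by (rule derivation2_subst2[OF that])
  note chain1 = chain[OF derivation2_partial_X1]
    and chain2 = chain[OF derivation2_pderiv]
  obtain A where A: "\<sigma> A = X1"
    using assms unfolding adjoin2_def \<sigma>_def by (metis UNIV_I imageE)
  obtain B where B: "\<sigma> B = X2"
    using assms unfolding adjoin2_def \<sigma>_def by (metis UNIV_I imageE)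
  have [simp]: "partial_X1 X1 = 1" "partial_X1 X2 = 0" "pderiv X1 = (0::cpoly2)" "pderiv X2 = (1::cpoly2)"
    by (simp_all add: partial_X1_generators) (simp_all add: X1_def X2_def pderiv_pCons)
  have down: "\<sigma> (partial_X1 P) = 0 \<and> \<sigma> (pderiv P) = 0" if "\<sigma> P = 0" for P
  proof -
    note eqs = chain1[of A] chain2[of A] chain1[of B] chain2[of B] chain1[of P] chain2[of P]
    have z: "partial_X1 (0::cpoly2) = 0" by (simp add: partial_X1_def)
    define a b c d where "a = partial_X1 y1" and "b = partial_X1 y2"
      and "c = (pderiv y1::cpoly2)" and "d = (pderiv y2::cpoly2)"
    define e f g h where "e = \<sigma> (partial_X1 A)" and "f = \<sigma> (pderiv A)"
      and "g = \<sigma> (partial_X1 B)" and "h = \<sigma> (pderiv B)"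
    define u v where "u = \<sigma> (partial_X1 P)" and "v = \<sigma> (pderiv P)"
    have *: "e * a + f * b = 1" "e * c + f * d = 0" "g * a + h * b = 0" "g * c + h * d = 1"
      "u * a + v * b = 0" "u * c + v * d = 0"
      using eqs unfolding A B that z pderiv_0
      by (simp_all add: a_def b_def c_def d_def e_def f_def g_def h_def u_def v_def)
    \<comment> \<open>\<open>a, b, c, d\<close> form the Jacobian matrix; the first four equations say that \<open>e, f, g, h\<close> form an
      inverse of it, the last two that \<open>(u, v)\<close> lies in its kernel.\<close>
    have "(a * d - b * c) * (e * h - f * g) = 1" using * by algebra
    then have nz: "a * d - b * c \<noteq> 0" by auto
    have "(a * d - b * c) * u = 0" "(a * d - b * c) * v = 0" using * by algebra+
    with nz have "u = 0" "v = 0" by (metis mult_eq_0_iff)+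
    then show ?thesis by (simp add: u_def v_def)
  qed
  have inner: "p = 0" if "\<sigma> [:p:] = 0" for p
    using that
  proof (induction "degree p" arbitrary: p rule: less_induct)
    case less
    have "partial_X1 [:p:] = [:pderiv p:]"
      by (simp add: partial_X1_def map_poly_pCons)
    with down[OF less.prems] have d0: "\<sigma> [:pderiv p:] = 0" by simp
    have "degree p = 0"
    proof (rule ccontr)
      assume "degree p \<noteq> 0"
      then have "degree (pderiv p) < degree p" by (simp add: degree_pderiv)
      from less.hyps[OF this d0] have "degree p = 0" by (simp add: pderiv_eq_0_iff)
      with \<open>degree p \<noteq> 0\<close> show False by simp
    qed
    then obtain c where c: "p = [:c:]" by (rule degree_eq_zeroE)
    have "\<sigma> [:p:] = const2 c"
      unfolding c \<sigma>_def using subst2_generators(1)[of y1 y2 c] by (simp add: const2_def)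
    with less.prems c show ?case by (simp add: const2_def)
  qed
  have ker: "P = 0" if "\<sigma> P = 0" for P
    using that
  proof (induction "degree P" arbitrary: P rule: less_induct)
    case less
    have d0: "\<sigma> (pderiv P) = 0" using down[OF less.prems] by simp
    have "degree P = 0"
    proof (rule ccontr)
      assume "degree P \<noteq> 0"
      then have "degree (pderiv P) < degree P" by (simp add: degree_pderiv)
      from less.hyps[OF this d0] have "degree P = 0" by (simp add: pderiv_eq_0_iff)
      with \<open>degree P \<noteq> 0\<close> show False by simp
    qed
    then obtain c where c: "P = [:c:]" by (rule degree_eq_zeroE)
    with inner less.prems show ?case by simp
  qed
  show ?thesis
  proof (rule injI)
    fix P Q assume "subst2 y1 y2 P = subst2 y1 y2 Q"
    then have "\<sigma> P - \<sigma> Q = 0" unfolding \<sigma>_def by simp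
    then have "\<sigma> (P - Q) = 0" by (simp only: s.diff)
    from ker[OF this] show "P = Q" by simp
  qed
qed

lemma partial1_subst2:
  assumes "inj (subst2 y1 y2)"
  shows "partial1 y1 y2 (subst2 y1 y2 P) = subst2 y1 y2 (partial_X1 P)"
proof -
  have "(THE Q. subst2 y1 y2 Q = subst2 y1 y2 P) = P"
    using assms by (auto simp: inj_eq)
  then show ?thesis by (simp add: partial1_def)
qed

lemma surj_pderiv: "surj (pderiv :: 'a::field_char_0 poly \<Rightarrow> 'a poly)"
proof (rule surjI)
  interpret p: derivation "pderiv :: 'a poly \<Rightarrow> 'a poly"
    by unfold_locales (simp_all add: pderiv_add pderiv_mult algebra_simps)
  fix p :: "'a poly"
  have "pderiv (monom (coeff p i / of_nat (Suc i)) (Suc i)) = monom (coeff p i) i" for i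
    by (simp add: pderiv_monom del: of_nat_Suc)
  then have "pderiv (\<Sum>i\<le>degree p. monom (coeff p i / of_nat (Suc i)) (Suc i)) = (\<Sum>i\<le>degree p. monom (coeff p i) i)"
    by (simp only: p.sum)
  then show "pderiv (\<Sum>i\<le>degree p. monom (coeff p i / of_nat (Suc i)) (Suc i)) = p"
    by (simp only: poly_as_sum_of_monoms)
qed

lemma surj_partial_X1: "surj partial_X1"
proof -
  define I where "I = (\<lambda>p::complex poly. if p = 0 then 0 else (SOME q. pderiv q = p))"
  have I: "pderiv (I p) = p" for p
  proof (cases "p = 0")
    case False
    have "\<exists>q. pderiv q = p" using surjD[OF surj_pderiv, of p] by auto
    from someI_ex[OF this] False show ?thesis by (simp add: I_def)
  qed (simp add: I_def)
  have I0: "I 0 = 0" by (simp add: I_def)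
  have "partial_X1 (map_poly I f) = f" for f
    by (rule poly_eqI) (simp only: partial_X1_def coeff_map_poly I I0 pderiv_0 refl)
  then show ?thesis by (rule surjI)
qed

lemma surj_and_kernel_if_partial1:
  assumes gen: "adjoin2 y1 y2 = UNIV" and D: "derivation2 D" "D = partial1 y1 y2"
  shows "surj D \<and> range const2 \<subset> ker2 D"
proof
  note inj = subst2_inj_if_generates[OF gen]
  interpret s: ring_morphism "subst2 y1 y2" by (rule ring_morphism_subst2)
  have D_subst: "D (subst2 y1 y2 P) = subst2 y1 y2 (partial_X1 P)" for P
    unfolding D(2) by (rule partial1_subst2[OF inj])
  show "surj D"
    unfolding surj_def
  proof
    fix g
    obtain P where "g = subst2 y1 y2 P" using gen unfolding adjoin2_def by auto
    moreover obtain Q where "P = partial_X1 Q" using surjD[OF surj_partial_X1, of P] by auto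
    ultimately have "g = D (subst2 y1 y2 Q)" by (simp only: D_subst)
    then show "\<exists>f. g = D f" ..
  qed
  have "D y2 = 0"
    using D_subst[of X2] by (simp add: subst2_generators partial_X1_generators s.zero)
  moreover have "y2 \<notin> range const2"
  proof
    assume "y2 \<in> range const2"
    then obtain c where "y2 = const2 c" by auto
    then have "subst2 y1 y2 X2 = subst2 y1 y2 (const2 c)" by (simp add: subst2_generators)
    with inj have "X2 = const2 c" by (simp add: inj_eq)
    then show False by (simp add: X2_def const2_def)
  qed
  ultimately show "range const2 \<subset> ker2 D"
    using derivation2_const2[OF D(1)] by (auto simp: ker2_def)
qed

section \<open>Three polynomials in two variables are algebraically dependent\<close>

lemma (in vector_space) nontrivial_relation:
  fixes v :: "'c \<Rightarrow> 'b"
  assumes fin: "finite I" "finite E" and span: "\<And>i. i \<in> I \<Longrightarrow> v i \<in> span E" and card: "card E < card I"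
  shows "\<exists>c. (\<exists>i\<in>I. c i \<noteq> 0) \<and> (\<Sum>i\<in>I. scale (c i) (v i)) = 0"
proof (cases "inj_on v I")
  case True
  have "dependent (v ` I)"
  proof (rule ccontr)
    assume "independent (v ` I)"
    then have "card (v ` I) \<le> card E"
      using independent_span_bound[OF fin(2)] span by blast
    with card card_image[OF True] show False by simp
  qed
  then obtain u where u: "\<exists>x\<in>v ` I. u x \<noteq> 0" "(\<Sum>x\<in>v ` I. scale (u x) x) = 0"
    using dependent_finite[of "v ` I"] fin(1) by auto
  have "(\<Sum>i\<in>I. scale (u (v i)) (v i)) = 0"
    using u(2) by (simp add: sum.reindex[OF True])
  with u(1) show ?thesis by (intro exI[of _ "u \<circ> v"]) auto
next
  case False
  then obtain i j where ij: "i \<in> I" "j \<in> I" "i \<noteq> j" "v i = v j"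
    by (auto simp: inj_on_def)
  define c :: "'c \<Rightarrow> 'a" where "c = (\<lambda>k. if k = i then 1 else if k = j then - 1 else 0)"
  have "(\<Sum>k\<in>I. scale (c k) (v k)) = (\<Sum>k\<in>{i, j}. scale (c k) (v k))"
    using ij fin(1) by (intro sum.mono_neutral_right) (auto simp: c_def)
  also have "\<dots> = 0" using ij by (simp add: c_def)
  finally show ?thesis using ij(1) by (intro exI[of _ c]) (auto simp: c_def)
qed

definition bidegree_le :: "nat \<Rightarrow> cpoly2 \<Rightarrow> bool" where
  "bidegree_le d g \<longleftrightarrow> degree g \<le> d \<and> (\<forall>i. degree (coeff g i) \<le> d)"

lemma bidegree_le_exists: "\<exists>d. bidegree_le d g"
proof -
  define d where "d = Max (insert (degree g) ((\<lambda>i. degree (coeff g i)) ` {..degree g}))"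
  have "degree g \<le> d" unfolding d_def by (rule Max_ge) auto
  moreover have "degree (coeff g i) \<le> d" for i
  proof (cases "i \<le> degree g")
    case True
    then show ?thesis unfolding d_def by (intro Max_ge) auto
  qed (simp add: coeff_eq_0)
  ultimately show ?thesis by (auto simp: bidegree_le_def)
qed

lemma bidegree_le_mono: "bidegree_le d g \<Longrightarrow> d \<le> e \<Longrightarrow> bidegree_le e g"
  by (auto simp: bidegree_le_def intro: order.trans)

lemma bidegree_le_mult:
  assumes "bidegree_le d g" "bidegree_le e h"
  shows "bidegree_le (d + e) (g * h)"
  unfolding bidegree_le_def
proof (intro conjI allI)
  show "degree (g * h) \<le> d + e"
    using assms degree_mult_le[of g h] by (auto simp: bidegree_le_def)
  fix n
  show "degree (coeff (g * h) n) \<le> d + e"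
    unfolding coeff_mult
  proof (rule degree_sum_le)
    fix i assume "i \<in> {..n}"
    have "degree (coeff g i * coeff h (n - i)) \<le> degree (coeff g i) + degree (coeff h (n - i))"
      by (rule degree_mult_le)
    also have "\<dots> \<le> d + e" using assms by (auto simp: bidegree_le_def intro: add_mono)
    finally show "degree (coeff g i * coeff h (n - i)) \<le> d + e" .
  qed simp
qed

lemma bidegree_le_power: "bidegree_le d g \<Longrightarrow> bidegree_le (n * d) (g ^ n)"
proof (induction n)
  case 0
  have "degree (coeff (1::cpoly2) i) = 0" for i by (cases i) (simp_all add: one_pCons)
  then show ?case by (simp add: bidegree_le_def)
next
  case (Suc n)
  then show ?case using bidegree_le_mult[of d g "n * d" "g ^ n"] by simp
qed

lemma bidegree_le_span:
  assumes "bidegree_le d g"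
  shows "g \<in> module.span scale2 ((\<lambda>(i, j). monom (monom 1 j) i) ` ({..d} \<times> {..d}))"
proof -
  interpret vector_space scale2 by (rule vector_space_scale2)
  have scale: "scale2 c (monom (monom 1 j) i) = monom (monom c j) i" for c i j
    by (simp add: scale2_def const2_def smult_monom)
  have "g = (\<Sum>i\<le>d. monom (coeff g i) i)"
    using assms by (simp add: bidegree_le_def poly_as_sum_of_monoms')
  also have "\<dots> = (\<Sum>i\<le>d. monom (\<Sum>j\<le>d. monom (coeff (coeff g i) j) j) i)"
    using assms by (simp add: bidegree_le_def poly_as_sum_of_monoms')
  also have "\<dots> = (\<Sum>i\<le>d. \<Sum>j\<le>d. scale2 (coeff (coeff g i) j) (monom (monom 1 j) i))"
    by (simp add: scale monom_sum)
  also have "\<dots> \<in> span ((\<lambda>(i, j). monom (monom 1 j) i) ` ({..d} \<times> {..d}))"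
    by (intro span_sum span_scale span_base) auto
  finally show ?thesis .
qed

lemma monom_monom_eq: "monom (monom c i) j = const2 c * X1 ^ i * X2 ^ j"
proof -
  have "X1 ^ i = [:monom 1 i:]"
    by (induction i) (simp_all add: X1_def monom_Suc one_pCons)
  moreover have "X2 ^ j = monom 1 j"
    by (simp add: X2_def monom_altdef)
  ultimately show ?thesis
    by (simp add: const2_def smult_monom)
qed

text \<open>
  Counting dimensions: for large \<open>m\<close> there are more monomials \<open>a\<^sup>i b\<^sup>j e\<^sup>k\<close> with \<open>i, j, k < m\<close>, namely
  \<open>m\<^sup>3\<close>, than dimensions in the space of polynomials of their bidegree, which grows like \<open>m\<^sup>2\<close>. The
  relation is stored as a polynomial in the third element over \<open>\<complex>[a, b]\<close>, the form in which it says
  that every element is algebraic over two independent ones.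
\<close>
lemma algebraic_relation:
  fixes a b e :: cpoly2
  obtains P where "P \<noteq> 0" "poly (map_poly (subst2 a b) P) e = 0"
proof -
  interpret vector_space scale2 by (rule vector_space_scale2)
  interpret s: ring_morphism "subst2 a b" by (rule ring_morphism_subst2)
  interpret v: ring_morphism "\<lambda>P. poly (map_poly (subst2 a b) P) e" by (rule s.ring_morphism_poly)
  obtain d1 d2 d3 where "bidegree_le d1 a" "bidegree_le d2 b" "bidegree_le d3 e"
    using bidegree_le_exists by meson
  then obtain d where d: "bidegree_le d a" "bidegree_le d b" "bidegree_le d e"
    using bidegree_le_mono[of _ _ "d1 + d2 + d3"] by (meson le_add1 le_add2 order.trans)
  \<comment> \<open>The \<open>m\<^sup>3\<close> monomials below have bidegree at most \<open>3md\<close>, and \<open>(3md + 1)\<^sup>2 \<le> m\<^sup>2 (3d + 1)\<^sup>2 < m\<^sup>3\<close>.\<close>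
  define m where "m = (3 * d + 1)\<^sup>2 + 1"
  define I where "I = {..<m} \<times> {..<m} \<times> {..<m}"
  define w where "w = (\<lambda>(i, j, k). a ^ i * b ^ j * e ^ k)"
  define E where "E = (\<lambda>(i, j). monom (monom (1::complex) j) i) ` ({..3 * m * d} \<times> {..3 * m * d})"
  have fin: "finite I" "finite E" by (simp_all add: I_def E_def)
  have "w x \<in> span E" if "x \<in> I" for x
  proof -
    obtain i j k where ijk: "x = (i, j, k)" by (cases x)
    with that have x: "x = (i, j, k)" "i < m" "j < m" "k < m" by (auto simp: I_def)
    have "bidegree_le (i * d + j * d + k * d) (w x)"
      unfolding w_def x by (simp, intro bidegree_le_mult bidegree_le_power d)
    moreover have "i * d + j * d + k * d \<le> 3 * m * d"
      using x mult_right_mono[of "i + j + k" "3 * m" d] by (simp add: algebra_simps)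
    ultimately show ?thesis unfolding E_def by (intro bidegree_le_span) (rule bidegree_le_mono)
  qed
  moreover have "card E < card I"
  proof -
    have "card E \<le> (3 * m * d + 1)\<^sup>2"
      unfolding E_def
      by (rule order.trans[OF card_image_le]) (simp_all add: card_cartesian_product power2_eq_square)
    also have "\<dots> \<le> (m * (3 * d + 1))\<^sup>2"
      by (rule power_mono) (simp_all add: m_def algebra_simps)
    also have "\<dots> = m\<^sup>2 * (3 * d + 1)\<^sup>2" by (rule power_mult_distrib)
    also have "\<dots> < m\<^sup>2 * m"
      by (rule mult_strict_left_mono) (simp_all add: m_def)
    also have "\<dots> = card I"
      by (simp add: I_def card_cartesian_product power2_eq_square)
    finally show ?thesis .
  qed
  ultimately obtain c where c: "\<exists>x\<in>I. c x \<noteq> 0" "(\<Sum>x\<in>I. scale2 (c x) (w x)) = 0"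
    using nontrivial_relation[OF fin] by blast
  define M where "M = (\<lambda>x. case x of (i, j, k) \<Rightarrow> monom (monom (monom (c x) i) j) k)"
  define P where "P = sum M I"
  have ev: "poly (map_poly (subst2 a b) (M x)) e = scale2 (c x) (w x)" for x
  proof -
    obtain i j k where x: "x = (i, j, k)" by (cases x)
    have "subst2 a b (monom (monom (c x) i) j) = const2 (c x) * a ^ i * b ^ j"
      by (simp add: monom_monom_eq s.mult s.power subst2_generators)
    then show ?thesis
      by (simp add: x M_def w_def scale2_def map_poly_monom s.zero poly_monom mult.assoc)
  qed
  have "poly (map_poly (subst2 a b) P) e = 0"
    unfolding P_def v.sum ev by (rule c(2))
  moreover have "P \<noteq> 0"
  proof -
    obtain i j k where x: "(i, j, k) \<in> I" "c (i, j, k) \<noteq> 0" using c(1) by auto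
    have "coeff (coeff (coeff P k) j) i = (\<Sum>x\<in>I. coeff (coeff (coeff (M x) k) j) i)"
      by (simp add: P_def coeff_sum)
    also have "\<dots> = (\<Sum>x\<in>I. if x = (i, j, k) then c x else 0)"
      by (rule sum.cong) (auto simp: M_def split: if_splits)
    also have "\<dots> = c (i, j, k)" using x fin by simp
    finally show ?thesis using x(2) by auto
  qed
  ultimately show thesis using that by blast
qed

section \<open>Rational functions whose multiples are all derivatives\<close>

lemma exists_prime_factor_degree_pos:
  fixes q :: cpoly2
  assumes "degree q > 0"
  shows "\<exists>\<pi>. prime_elem \<pi> \<and> \<pi> dvd q \<and> degree \<pi> > 0"
  using assms
proof (induction q rule: prime_divisors_induct)
  case (unit x)
  then have "degree x = 0" by (auto simp: is_unit_poly_iff)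
  with unit show ?case by simp
next
  case (factor p x)
  show ?case
  proof (cases "degree p > 0")
    case True
    with factor show ?thesis by auto
  next
    case False
    with factor.prems degree_mult_le[of p x] have "degree x > 0" by simp
    with factor.IH show ?thesis by (auto intro: dvd_mult)
  qed
qed simp

text \<open>
  The equation would say \<open>p / \<pi> = (\<alpha> / \<beta>)'\<close>, where the left side has a simple pole along \<open>\<pi>\<close>. If \<open>\<pi>\<close>
  does not divide the denominator of \<open>\<alpha> / \<beta>\<close> in lowest terms, the derivative has no pole along
  \<open>\<pi>\<close> either; a pole of order \<open>k \<ge> 1\<close> becomes one of order exactly \<open>k + 1 \<ge> 2\<close>, because \<open>\<pi>\<close>
  does not divide \<open>k \<pi>'\<close> in characteristic 0.
\<close>
lemma no_derivative_with_simple_pole: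
  fixes \<pi> p \<alpha> \<beta> :: cpoly2
  assumes \<pi>: "prime_elem \<pi>" "degree \<pi> > 0" and p: "\<not> \<pi> dvd p" and \<beta>: "\<beta> \<noteq> 0"
  shows "p * \<beta>\<^sup>2 \<noteq> \<pi> * (pderiv \<alpha> * \<beta> - \<alpha> * pderiv \<beta>)"
proof
  assume eq: "p * \<beta>\<^sup>2 = \<pi> * (pderiv \<alpha> * \<beta> - \<alpha> * pderiv \<beta>)"
  define g where "g = gcd \<alpha> \<beta>"
  have g: "g \<noteq> 0" using \<beta> by (simp add: g_def)
  obtain \<alpha>1 \<beta>1 where ab: "\<alpha> = g * \<alpha>1" "\<beta> = g * \<beta>1" "coprime \<alpha>1 \<beta>1"
    using gcd_coprime_exists[of \<alpha> \<beta>] g unfolding g_def by (metis mult.commute)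
  have "g\<^sup>2 * (p * \<beta>1\<^sup>2) = g\<^sup>2 * (\<pi> * (pderiv \<alpha>1 * \<beta>1 - \<alpha>1 * pderiv \<beta>1))"
    using eq by (simp add: ab pderiv_mult algebra_simps power2_eq_square)
  with g have eq1: "p * \<beta>1\<^sup>2 = \<pi> * (pderiv \<alpha>1 * \<beta>1 - \<alpha>1 * pderiv \<beta>1)" by simp
  have \<beta>1: "\<beta>1 \<noteq> 0" using ab \<beta> by auto
  have "\<pi> dvd \<beta>1"
    using eq1 p \<pi>(1) by (metis dvd_triv_left prime_elem_dvd_mult_iff prime_elem_dvd_power)
  then have \<alpha>1: "\<not> \<pi> dvd \<alpha>1"
    using ab(3) \<pi>(1) by (meson coprime_common_divisor prime_elem_not_unit)
  obtain \<gamma> where \<gamma>: "\<beta>1 = \<pi> ^ multiplicity \<pi> \<beta>1 * \<gamma>" "\<not> \<pi> dvd \<gamma>"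
    using multiplicity_decompose'[of \<beta>1 \<pi>] \<beta>1 \<pi>(1) by auto
  obtain k where k: "multiplicity \<pi> \<beta>1 = Suc k"
    using \<open>\<pi> dvd \<beta>1\<close> \<beta>1 \<pi>(1) by (metis \<gamma> multiplicity_eq_zero_iff mult_1 not0_implies_Suc power_0)
  have \<beta>1': "\<beta>1 = \<pi> ^ Suc k * \<gamma>" using \<gamma>(1) k by simp
  have "\<pi> ^ Suc k * (p * \<pi> ^ Suc k * \<gamma>\<^sup>2) = \<pi> ^ Suc k *
      (\<pi> * (pderiv \<alpha>1 * \<gamma> - \<alpha>1 * pderiv \<gamma>) - \<alpha>1 * \<gamma> * (of_nat (Suc k) * pderiv \<pi>))"
    using eq1 unfolding \<beta>1' pderiv_mult pderiv_power_Suc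
    by (simp add: algebra_simps power2_eq_square of_nat_poly del: of_nat_Suc)
  then have "p * \<pi> ^ Suc k * \<gamma>\<^sup>2 =
      \<pi> * (pderiv \<alpha>1 * \<gamma> - \<alpha>1 * pderiv \<gamma>) - \<alpha>1 * \<gamma> * (of_nat (Suc k) * pderiv \<pi>)"
    using \<pi>(1) by (simp del: power_Suc of_nat_Suc) 
  then have "\<alpha>1 * \<gamma> * (of_nat (Suc k) * pderiv \<pi>) =
      \<pi> * (pderiv \<alpha>1 * \<gamma> - \<alpha>1 * pderiv \<gamma> - p * \<pi> ^ k * \<gamma>\<^sup>2)"
    by (simp add: algebra_simps del: of_nat_Suc)
  then have "\<pi> dvd \<alpha>1 * \<gamma> * (of_nat (Suc k) * pderiv \<pi>)" by simp
  then have "\<pi> dvd of_nat (Suc k) * pderiv \<pi>"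
    using \<pi>(1) \<alpha>1 \<gamma>(2) by (simp add: prime_elem_dvd_mult_iff)
  moreover have nz: "pderiv \<pi> \<noteq> 0" using \<pi>(2) by (simp add: pderiv_eq_0_iff)
  moreover have "of_nat (Suc k) * pderiv \<pi> \<noteq> 0" using nz by (simp del: of_nat_Suc)
  ultimately have "degree \<pi> \<le> degree (of_nat (Suc k) * pderiv \<pi>)"
    by (intro dvd_imp_degree_le)
  also have "\<dots> \<le> degree (pderiv \<pi>)"
    using degree_mult_le[of "of_nat (Suc k)" "pderiv \<pi>"] by (simp del: of_nat_Suc)
  also have "\<dots> < degree \<pi>" using \<pi>(2) by (simp add: degree_pderiv)
  finally show False by simp
qed

text \<open>
  The hypothesis says that every multiple of \<open>p / q\<close> is the derivative of a rational function with
  respect to the outer variable. If the reduced denominator had a prime factor \<open>\<pi>\<close> of positive degree,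
  multiplying by the cofactor of \<open>\<pi>\<close> would leave a simple pole. So only a factor \<open>a\<close> from the
  inner variable remains in the denominator.
\<close>
lemma denominator_free_if_multiples_derivatives:
  fixes p q :: cpoly2
  assumes q: "q \<noteq> 0"
    and deriv: "\<And>u. \<exists>\<alpha> \<beta>. \<beta> \<noteq> 0 \<and> u * p * \<beta>\<^sup>2 = q * (pderiv \<alpha> * \<beta> - \<alpha> * pderiv \<beta>)"
  obtains a r where "a \<noteq> 0" "smult a p = q * r"
proof -
  define g where "g = gcd p q"
  have g: "g \<noteq> 0" using q by (simp add: g_def)
  obtain p1 q1 where pq: "p = g * p1" "q = g * q1" "coprime p1 q1"
    using gcd_coprime_exists[of p q] g unfolding g_def by (metis mult.commute)
  have q1: "q1 \<noteq> 0" using q pq by auto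
  have "degree q1 = 0"
  proof (rule ccontr)
    assume "degree q1 \<noteq> 0"
    then obtain \<pi> where \<pi>: "prime_elem \<pi>" "\<pi> dvd q1" "degree \<pi> > 0"
      using exists_prime_factor_degree_pos[of q1] by auto
    then obtain w where w: "q1 = \<pi> * w" by (auto elim: dvdE)
    have "\<not> \<pi> dvd p1"
      using pq(3) \<pi>(1,2) by (meson coprime_common_divisor prime_elem_not_unit)
    moreover obtain \<alpha> \<beta> where ab: "\<beta> \<noteq> 0" "w * p * \<beta>\<^sup>2 = q * (pderiv \<alpha> * \<beta> - \<alpha> * pderiv \<beta>)"
      using deriv[of w] by auto
    moreover from ab(2) have "(g * w) * (p1 * \<beta>\<^sup>2) = (g * w) * (\<pi> * (pderiv \<alpha> * \<beta> - \<alpha> * pderiv \<beta>))"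
      by (simp only: pq w mult_ac)
    moreover have "g * w \<noteq> 0" using g q1 w by auto
    ultimately show False
      using no_derivative_with_simple_pole[OF \<pi>(1,3)] by (metis mult_left_cancel)
  qed
  then obtain a where a: "q1 = [:a:]" by (rule degree_eq_zeroE)
  with q1 have "a \<noteq> 0" by auto
  moreover have "smult a p = q * p1" by (simp add: pq a)
  ultimately show ?thesis using that by blast
qed

section \<open>Finite generation up to constants\<close>

text \<open>
  Vectors of polynomials, closed under linear combinations and under cancelling nonzero elements of
  the coefficient ring. With \<open>K\<close> the fraction field of the coefficient ring, these are the
  intersections of \<open>K[X]\<close>-submodules with the vectors of polynomials; they allow the use of
  noetherianity over \<open>K[X]\<close> without introducing \<open>K\<close>.
\<close>
definition saturated_submodule :: "(nat \<Rightarrow> 'a::idom poly) set \<Rightarrow> bool" where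
  "saturated_submodule M \<longleftrightarrow>
     (\<lambda>_. 0) \<in> M \<and>
     (\<forall>v\<in>M. \<forall>w\<in>M. \<forall>p q. (\<lambda>i. p * v i + q * w i) \<in> M) \<and>
     (\<forall>v a. a \<noteq> 0 \<longrightarrow> (\<lambda>i. smult a (v i)) \<in> M \<longrightarrow> v \<in> M)"

text \<open>
  Ascending chains stabilise coordinate by coordinate: the vectors with vanishing last coordinate form
  a chain with fewer coordinates, and in the last coordinate the least degree of a nonzero entry in the
  union of the chain is attained at some stage. From then on pseudo-division by that entry reduces any
  vector to one with vanishing last coordinate.
\<close>
lemma saturated_submodule_chain:
  fixes M :: "nat \<Rightarrow> (nat \<Rightarrow> 'a::idom poly) set"
  assumes "\<And>k. saturated_submodule (M k)" and "mono M" and "\<And>k v i. v \<in> M k \<Longrightarrow> i \<ge> n \<Longrightarrow> v i = 0"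
  shows "\<exists>N. \<forall>k\<ge>N. M k = M N"
  using assms
proof (induction n arbitrary: M)
  case 0
  have "M k = {\<lambda>_. 0}" for k
    using 0(1)[of k] 0(3)[of _ k] by (auto simp: saturated_submodule_def)
  then show ?case by auto
next
  case (Suc n)
  note lin = Suc.prems(1)[unfolded saturated_submodule_def, THEN conjunct2, THEN conjunct1, rule_format]
  note sat = Suc.prems(1)[unfolded saturated_submodule_def, THEN conjunct2, THEN conjunct2, rule_format]
  note mono = monoD[OF Suc.prems(2)]
  define M' where "M' = (\<lambda>k. {v \<in> M k. v n = 0})"
  have "\<exists>N. \<forall>k\<ge>N. M' k = M' N"
  proof (rule Suc.IH)
    show "saturated_submodule (M' k)" for k
      using Suc.prems(1)[of k] by (auto simp: saturated_submodule_def M'_def)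
    show "mono M'" using mono by (intro monoI) (auto simp: M'_def)
    show "v i = 0" if "v \<in> M' k" "i \<ge> n" for k v i
      using that Suc.prems(3)[of v k i] by (cases "i = n") (auto simp: M'_def)
  qed
  then obtain N1 where N1: "\<And>k. k \<ge> N1 \<Longrightarrow> M' k = M' N1" by auto
  show ?case
  proof (cases "\<exists>k. \<exists>v\<in>M k. v n \<noteq> 0")
    case False
    then have "M k = M' k" for k by (auto simp: M'_def)
    with N1 show ?thesis by auto
  next
    case True
    define Q where "Q = (\<lambda>d. \<exists>k. \<exists>v\<in>M k. v n \<noteq> 0 \<and> degree (v n) = d)"
    define d where "d = (LEAST d. Q d)"
    have "\<exists>d. Q d" using True by (auto simp: Q_def)
    then have "Q d" unfolding d_def by (rule LeastI_ex)
    then obtain N2 v where v: "v \<in> M N2" "v n \<noteq> 0" "degree (v n) = d" by (auto simp: Q_def)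
    have least: "degree (w n) \<ge> d" if "w \<in> M k" "w n \<noteq> 0" for w k
      unfolding d_def using that by (intro Least_le) (auto simp: Q_def)
    define N where "N = max N1 N2"
    have "M k \<subseteq> M N" if k: "k \<ge> N" for k
    proof
      fix w assume w: "w \<in> M k"
      obtain q r where "pseudo_divmod (w n) (v n) = (q, r)" by fastforce
      define a where "a = coeff (v n) (degree (v n)) ^ (Suc (degree (w n)) - degree (v n))"
      note pd = pseudo_divmod[OF v(2) \<open>pseudo_divmod (w n) (v n) = (q, r)\<close>, folded a_def]
      have a: "a \<noteq> 0" using v(2) by (simp add: a_def)
      define u where "u = (\<lambda>i. [:a:] * w i + (- q) * v i)"
      have "v \<in> M k" using v(1) mono[of N2 k] k by (auto simp: N_def)
      then have u: "u \<in> M k" unfolding u_def by (intro lin w)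
      have "u n = r" using pd(1) by (simp add: u_def algebra_simps)
      with least[OF u] pd(2) v(3) have "u n = 0" by fastforce
      with u have "u \<in> M' k" by (simp add: M'_def)
      also have "M' k = M' N" using N1[of k] N1[of N] k by (simp add: N_def)
      finally have "u \<in> M N" by (simp add: M'_def)
      moreover have "v \<in> M N" using v(1) mono[of N2 N] by (auto simp: N_def)
      ultimately have "(\<lambda>i. 1 * u i + q * v i) \<in> M N" by (intro lin)
      then have "(\<lambda>i. smult a (w i)) \<in> M N" by (simp add: u_def)
      with a show "w \<in> M N" by (rule sat)
    qed
    with mono show ?thesis by (intro exI[of _ N]) blast
  qed
qed

text \<open>
  The saturated submodules generated by the first \<open>k\<close> vectors form a chain, and equality of two
  consecutive members is the claimed relation.
\<close>
lemma eventually_dependent_on_predecessors: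
  fixes v :: "nat \<Rightarrow> nat \<Rightarrow> 'a::idom poly"
  assumes supp: "\<And>k i. i \<ge> n \<Longrightarrow> v k i = 0"
  shows "\<exists>N a c. a \<noteq> 0 \<and> (\<forall>i. smult a (v N i) = (\<Sum>k<N. c k * v k i))"
proof -
  define M where "M = (\<lambda>k. {w. \<exists>a c. a \<noteq> 0 \<and> (\<forall>i. smult a (w i) = (\<Sum>j<k. c j * v j i))})"
  have "\<exists>N. \<forall>k\<ge>N. M k = M N"
  proof (rule saturated_submodule_chain)
    show "saturated_submodule (M k)" for k
      unfolding saturated_submodule_def
    proof (intro conjI ballI allI impI)
      show "(\<lambda>_. 0) \<in> M k"
        unfolding M_def by (intro CollectI exI[of _ 1] exI[of _ "\<lambda>_. 0"]) simp
    next
      fix x y p q assume "x \<in> M k" "y \<in> M k"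
      then obtain a b c d where ab: "a \<noteq> 0" "b \<noteq> 0"
        "\<And>i. smult a (x i) = (\<Sum>j<k. c j * v j i)" "\<And>i. smult b (y i) = (\<Sum>j<k. d j * v j i)"
        unfolding M_def by blast
      have "smult (a * b) (p * x i + q * y i) = (\<Sum>j<k. (smult b p * c j + smult a q * d j) * v j i)" for i
      proof -
        have "smult (a * b) (p * x i + q * y i) = smult b p * smult a (x i) + smult a q * smult b (y i)"
          by (simp add: smult_add_right mult.commute)
        also have "\<dots> = (\<Sum>j<k. (smult b p * c j + smult a q * d j) * v j i)"
          unfolding ab(3,4) sum_distrib_left sum.distrib[symmetric]
          by (simp only: distrib_right mult.assoc)
        finally show ?thesis .
      qed
      with ab(1,2) show "(\<lambda>i. p * x i + q * y i) \<in> M k"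
        unfolding M_def by (intro CollectI exI[of _ "a * b"]) auto
    next
      fix x and a :: 'a assume a: "a \<noteq> 0" and "(\<lambda>i. smult a (x i)) \<in> M k"
      then obtain b c where "b \<noteq> 0" "\<And>i. smult b (smult a (x i)) = (\<Sum>j<k. c j * v j i)"
        unfolding M_def by blast
      with a show "x \<in> M k"
        unfolding M_def by (intro CollectI exI[of _ "b * a"] exI[of _ c]) simp
    qed
    show "mono M"
    proof (intro monoI subsetI)
      fix k l :: nat and w assume kl: "k \<le> l" and "w \<in> M k"
      then obtain a c where ac: "a \<noteq> 0" "\<And>i. smult a (w i) = (\<Sum>j<k. c j * v j i)"
        unfolding M_def by blast
      have "(\<Sum>j<l. (if j < k then c j else 0) * v j i) = (\<Sum>j<k. c j * v j i)" for i
        using kl by (intro sum.mono_neutral_cong_right) auto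
      with ac show "w \<in> M l"
        unfolding M_def by (intro CollectI exI[of _ a] exI[of _ "\<lambda>j. if j < k then c j else 0"]) simp
    qed
    show "w i = 0" if "w \<in> M k" "i \<ge> n" for k w i
    proof -
      from that(1) obtain a c where "a \<noteq> 0" "smult a (w i) = (\<Sum>j<k. c j * v j i)"
        unfolding M_def by blast
      with supp[OF that(2)] show ?thesis by simp
    qed
  qed
  then obtain N where N: "M (Suc N) = M N" by (metis le_Suc_eq order_refl)
  have "v N \<in> M (Suc N)"
    unfolding M_def
  proof (intro CollectI exI conjI allI)
    show "(1::'a) \<noteq> 0" by simp
    show "smult 1 (v N i) = (\<Sum>j<Suc N. (if j = N then 1 else 0) * v j i)" for i
      by simp
  qed
  then have "v N \<in> M N" by (simp add: N)
  then show ?thesis unfolding M_def by blast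
qed

section \<open>Morphisms and derivations of fraction fields\<close>

lemma ring_morphism_fract:
  fixes h :: "'a::idom \<Rightarrow> 'b::idom"
  assumes "ring_morphism h" and inj: "\<And>a. h a = 0 \<Longrightarrow> a = 0"
  obtains \<iota> where "ring_morphism \<iota>" "\<And>a b. b \<noteq> 0 \<Longrightarrow> \<iota> (Fract a b) = Fract (h a) (h b)"
proof -
  interpret h: ring_morphism h by fact
  define \<iota> where "\<iota> = (\<lambda>q. SOME r. \<exists>a b. b \<noteq> 0 \<and> q = Fract a b \<and> r = Fract (h a) (h b))"
  have \<iota>: "\<iota> (Fract a b) = Fract (h a) (h b)" if b: "b \<noteq> 0" for a b
    unfolding \<iota>_def
  proof (rule some_equality)
    show "\<exists>a' b'. b' \<noteq> 0 \<and> Fract a b = Fract a' b' \<and> Fract (h a) (h b) = Fract (h a') (h b')"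
      using b by blast
    fix r assume "\<exists>a' b'. b' \<noteq> 0 \<and> Fract a b = Fract a' b' \<and> r = Fract (h a') (h b')"
    then obtain a' b' where *: "b' \<noteq> 0" "a * b' = a' * b" "r = Fract (h a') (h b')"
      using b by (auto simp: eq_fract)
    have nz: "h b \<noteq> 0" "h b' \<noteq> 0" using b *(1) inj by blast+
    have "h a * h b' = h a' * h b" using *(2) by (metis h.mult)
    with nz show "r = Fract (h a) (h b)" by (simp add: *(3) eq_fract)
  qed
  have "ring_morphism \<iota>"
  proof
    show "\<iota> 1 = 1" by (simp add: One_fract_def \<iota> h.one)
    show "\<iota> (x + y) = \<iota> x + \<iota> y" for x y
    proof (cases x, cases y)
      fix a b c d assume x: "x = Fract a b" "b \<noteq> 0" and y: "y = Fract c d" "d \<noteq> 0"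
      with inj have "h b \<noteq> 0" "h d \<noteq> 0" by blast+
      with x y show ?thesis by (simp add: \<iota> h.add h.mult)
    qed
    show "\<iota> (x * y) = \<iota> x * \<iota> y" for x y
      by (cases x, cases y) (simp add: \<iota> h.mult)
  qed
  from that[OF this \<iota>] show ?thesis .
qed

lemma derivation_fract:
  fixes d :: "'a::idom \<Rightarrow> 'a"
  assumes "derivation d"
  obtains \<delta> where "derivation \<delta>" "\<And>a b. b \<noteq> 0 \<Longrightarrow> \<delta> (Fract a b) = Fract (d a * b - a * d b) (b * b)"
proof -
  interpret d: derivation d by fact
  define \<delta> where "\<delta> = (\<lambda>q. SOME r. \<exists>a b. b \<noteq> 0 \<and> q = Fract a b \<and> r = Fract (d a * b - a * d b) (b * b))"
  have \<delta>: "\<delta> (Fract a b) = Fract (d a * b - a * d b) (b * b)" if b: "b \<noteq> 0" for a b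
    unfolding \<delta>_def
  proof (rule some_equality)
    show "\<exists>a' b'. b' \<noteq> 0 \<and> Fract a b = Fract a' b' \<and>
        Fract (d a * b - a * d b) (b * b) = Fract (d a' * b' - a' * d b') (b' * b')"
      using b by blast
    fix r assume "\<exists>a' b'. b' \<noteq> 0 \<and> Fract a b = Fract a' b' \<and> r = Fract (d a' * b' - a' * d b') (b' * b')"
    then obtain a' b' where *: "b' \<noteq> 0" "a * b' = a' * b" "r = Fract (d a' * b' - a' * d b') (b' * b')"
      using b by (auto simp: eq_fract)
    have "d (a * b') = d (a' * b)" using *(2) by simp
    then have "a * d b' + d a * b' = a' * d b + d a' * b" by (simp only: d.mult)
    with *(2) have "(d a' * b' - a' * d b') * (b * b) = (d a * b - a * d b) * (b' * b')" by algebra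
    with b *(1) show "r = Fract (d a * b - a * d b) (b * b)" by (simp add: *(3) eq_fract)
  qed
  have "derivation \<delta>"
  proof
    fix x y :: "'a fract"
    obtain a b where x: "x = Fract a b" "b \<noteq> 0" by (cases x)
    obtain c e where y: "y = Fract c e" "e \<noteq> 0" by (cases y)
    show "\<delta> (x + y) = \<delta> x + \<delta> y"
      using x(2) y(2) by (simp add: x y \<delta> d.add d.mult eq_fract algebra_simps)
    show "\<delta> (x * y) = x * \<delta> y + \<delta> x * y"
      using x(2) y(2) by (simp add: x y \<delta> d.mult eq_fract algebra_simps)
  qed
  from that[OF this \<delta>] show ?thesis .
qed

section \<open>The trace commutes with derivations\<close>

text \<open>
  The trace of multiplication by \<open>v\<close> on a finite-dimensional algebra \<open>V\<close> over \<open>\<iota>(k)\<close>. If \<open>M(v)\<close> is the matrix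
  of multiplication by \<open>v\<close> in a basis and \<open>A\<close> expresses the derivatives of the basis vectors in the
  basis, then \<open>M(\<delta> v)\<close> is the entrywise derivative of \<open>M(v)\<close> plus a commutator of \<open>M(v)\<close> and \<open>A\<close>;
  the commutator has trace zero.
\<close>
lemma horizontal_trace_exists:
  fixes \<iota> :: "'k::field \<Rightarrow> 'l::field" and G :: "'l set"
  assumes \<iota>: "ring_morphism \<iota>" and \<delta>: "derivation \<delta>" and \<epsilon>: "derivation \<epsilon>"
    and compat: "\<And>c. \<delta> (\<iota> c) = \<iota> (\<epsilon> c)"
    and V: "V = module.span (\<lambda>c v. \<iota> c * v) G" "finite G" "1 \<in> V"
      "\<And>v w. v \<in> V \<Longrightarrow> w \<in> V \<Longrightarrow> v * w \<in> V" "\<And>v. v \<in> V \<Longrightarrow> \<delta> v \<in> V"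
  obtains tr n where "\<And>v w. v \<in> V \<Longrightarrow> w \<in> V \<Longrightarrow> tr (v + w) = tr v + tr w"
    "\<And>c v. v \<in> V \<Longrightarrow> tr (\<iota> c * v) = c * tr v" "tr 1 = of_nat n" "n > 0"
    "\<And>v. v \<in> V \<Longrightarrow> tr (\<delta> v) = \<epsilon> (tr v)"
proof -
  interpret \<iota>: ring_morphism \<iota> by fact
  interpret \<delta>: derivation \<delta> by fact
  interpret \<epsilon>: derivation \<epsilon> by fact
  interpret vector_space "\<lambda>c v. \<iota> c * v"
    by unfold_locales (simp_all add: \<iota>.add \<iota>.mult \<iota>.one algebra_simps)
  obtain E where E: "E \<subseteq> G" "independent E" "G \<subseteq> span E"
    using maximal_independent_subset[of G] by metis
  have fin: "finite E" using E(1) V(2) finite_subset by blast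
  have VE: "V = span E"
    using span_mono[OF E(1)] span_minimal[OF E(3) subspace_span] V(1) by blast
  have base: "b \<in> V" if "b \<in> E" for b using that by (simp add: VE span_base)
  define rep where "rep = representation E"
  have rep_add: "rep (v + w) e = rep v e + rep w e" if "v \<in> V" "w \<in> V" for v w e
    using that representation_add[OF E(2)] by (simp add: rep_def VE)
  have rep_scale: "rep (\<iota> c * v) e = c * rep v e" if "v \<in> V" for c v e
    using that representation_scale[OF E(2)] by (simp add: rep_def VE)
  have rep_eq: "(\<Sum>b\<in>E. \<iota> (rep v b) * b) = v" if "v \<in> V" for v
    using that sum_representation_eq[OF E(2) _ fin order_refl] by (simp add: rep_def VE)
  have sc: "\<iota> c * v \<in> V" if "v \<in> V" for c v
    using that span_scale by (simp add: VE)
  have sumV: "(\<Sum>i\<in>I. f i) \<in> V" if "\<And>i. i \<in> I \<Longrightarrow> f i \<in> V" for I :: "'l set" and f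
    using that unfolding VE by (rule span_sum)
  have rep_sum: "rep (\<Sum>i\<in>I. f i) e = (\<Sum>i\<in>I. rep (f i) e)"
    if "finite I" "\<And>i. i \<in> I \<Longrightarrow> f i \<in> V" for I :: "'l set" and f e
    using that
  proof (induction I rule: finite_induct)
    case empty
    show ?case by (simp add: rep_def representation_zero)
  qed (simp add: rep_add sumV)
  define tr where "tr = (\<lambda>v. \<Sum>b\<in>E. rep (v * b) b)"
  have tr_add: "tr (v + w) = tr v + tr w" if "v \<in> V" "w \<in> V" for v w
    using that by (simp add: tr_def distrib_right rep_add V(4) base sum.distrib)
  have tr_scale: "tr (\<iota> c * v) = c * tr v" if "v \<in> V" for c v
    using that by (simp add: tr_def mult.assoc rep_scale V(4) base sum_distrib_left)
  have "rep b b = 1" if "b \<in> E" for b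
    using that representation_basis[OF E(2)] by (simp add: rep_def)
  then have tr_1: "tr 1 = of_nat (card E)" by (simp add: tr_def)
  have "E \<noteq> {}" using V(3) by (auto simp: VE)
  then have "card E > 0" using fin by (simp add: card_gt_0_iff)
  have tr_deriv: "tr (\<delta> v) = \<epsilon> (tr v)" if v: "v \<in> V" for v
  proof -
    \<comment> \<open>The \<open>(b, e)\<close> entry of the matrix identity: compute \<open>\<delta> (v b)\<close> by the Leibniz rule and
      from the expansion of \<open>v b\<close> in the basis.\<close>
    have step: "rep (\<delta> v * b) e + (\<Sum>c\<in>E. rep (\<delta> b) c * rep (v * c) e) =
        \<epsilon> (rep (v * b) e) + (\<Sum>c\<in>E. rep (v * b) c * rep (\<delta> c) e)" if b: "b \<in> E" and e: "e \<in> E" for b e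
    proof -
      have db: "\<delta> b \<in> V" and vb: "v * b \<in> V" using V(4,5) v b base by auto
      have "rep (\<delta> (v * b)) e = rep (v * \<delta> b) e + rep (\<delta> v * b) e"
        by (simp add: \<delta>.mult rep_add V(4,5) v b base db)
      moreover have "rep (v * \<delta> b) e = (\<Sum>c\<in>E. rep (\<delta> b) c * rep (v * c) e)"
      proof -
        have "v * \<delta> b = (\<Sum>c\<in>E. \<iota> (rep (\<delta> b) c) * (v * c))"
          by (subst rep_eq[OF db, symmetric]) (simp add: sum_distrib_left mult_ac)
        then show ?thesis by (simp add: rep_sum fin sc V(4) v base rep_scale)
      qed
      moreover have "rep (\<delta> (v * b)) e = \<epsilon> (rep (v * b) e) + (\<Sum>c\<in>E. rep (v * b) c * rep (\<delta> c) e)"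
      proof -
        have "\<delta> (v * b) = (\<Sum>c\<in>E. \<delta> (\<iota> (rep (v * b) c) * c))"
          by (subst rep_eq[OF vb, symmetric]) (simp add: \<delta>.sum)
        also have "\<dots> = (\<Sum>c\<in>E. \<iota> (rep (v * b) c) * \<delta> c + \<iota> (\<epsilon> (rep (v * b) c)) * c)"
          by (simp add: \<delta>.mult compat)
        finally have "rep (\<delta> (v * b)) e = (\<Sum>c\<in>E. rep (v * b) c * rep (\<delta> c) e + \<epsilon> (rep (v * b) c) * rep c e)"
          by (simp add: rep_sum fin span_add sc base V(5) rep_add rep_scale VE[symmetric] subspace_add[OF subspace_span[of E], folded VE])
        also have "\<dots> = (\<Sum>c\<in>E. rep (v * b) c * rep (\<delta> c) e) + (\<Sum>c\<in>E. \<epsilon> (rep (v * b) c) * rep c e)"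
          by (rule sum.distrib)
        also have "(\<Sum>c\<in>E. \<epsilon> (rep (v * b) c) * rep c e) = (\<Sum>c\<in>E. if c = e then \<epsilon> (rep (v * b) c) else 0)"
          by (rule sum.cong) (auto simp: rep_def representation_basis[OF E(2)])
        also have "\<dots> = \<epsilon> (rep (v * b) e)" using e fin by simp
        finally show ?thesis by simp
      qed
      ultimately show ?thesis by simp
    qed
    have "tr (\<delta> v) + (\<Sum>b\<in>E. \<Sum>c\<in>E. rep (\<delta> b) c * rep (v * c) b) =
        \<epsilon> (tr v) + (\<Sum>b\<in>E. \<Sum>c\<in>E. rep (v * b) c * rep (\<delta> c) b)"
      unfolding tr_def \<epsilon>.sum sum.distrib[symmetric] by (rule sum.cong) (auto intro: step)
    also have "(\<Sum>b\<in>E. \<Sum>c\<in>E. rep (v * b) c * rep (\<delta> c) b) = (\<Sum>b\<in>E. \<Sum>c\<in>E. rep (\<delta> b) c * rep (v * c) b)"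
      by (subst sum.swap) (simp only: mult.commute)
    finally show ?thesis by simp
  qed
  show ?thesis by (rule that[OF tr_add tr_scale tr_1 \<open>card E > 0\<close> tr_deriv])
qed

section \<open>Derivations with a slice\<close>

text \<open>
  \<open>s\<close> is a slice and \<open>f\<close> a nonconstant constant of \<open>D\<close>. Polynomials in \<open>(f, s)\<close> are written as
  \<open>\<sigma> P = subst2 f s P\<close>, so that \<open>s\<close> is the outer variable of \<open>P\<close> and \<open>D\<close> becomes the derivation
  \<open>pderiv\<close>, while the coefficients \<open>\<sigma> [:a:] = a(f)\<close> are constants of \<open>D\<close>.
\<close>
locale slice_derivation =
  fixes D :: "cpoly2 \<Rightarrow> cpoly2" and f s :: cpoly2
  assumes derivation2: "derivation2 D" and D_f: "D f = 0" and f_nonconst: "f \<notin> range const2"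
    and D_s: "D s = 1"
begin

sublocale D: derivation D by (rule derivation2_derivation[OF derivation2])

abbreviation \<sigma> :: "cpoly2 \<Rightarrow> cpoly2" where "\<sigma> \<equiv> subst2 f s"

sublocale \<sigma>: ring_morphism \<sigma> by (rule ring_morphism_subst2)

lemma D_\<sigma>: "D (\<sigma> P) = \<sigma> (pderiv P)"
  using derivation2_subst2[OF derivation2, of f s P] by (simp add: D_f D_s)

lemma \<sigma>_inner: "\<sigma> [:p:] = poly (map_poly const2 p) f"
  by (simp add: subst2_def map_poly_pCons)

lemma \<sigma>_inner_eq_0: "\<sigma> [:p:] = 0 \<Longrightarrow> p = 0"
proof (induction "degree p" arbitrary: p rule: less_induct)
  case less
  interpret c: ring_morphism const2 by (rule ring_morphism_const2)
  interpret \<rho>: ring_morphism "\<lambda>p. poly (map_poly const2 p) f" by (rule c.ring_morphism_poly)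
  show ?case
  proof (cases "degree p = 0")
    case True
    then obtain c where p: "p = [:c:]" by (rule degree_eq_zeroE)
    with less.prems show ?thesis by (simp add: \<sigma>_inner map_poly_pCons const2_def)
  next
    case False
    then obtain r where "poly p r = 0"
      using Fundamental_Theorem_Algebra.fundamental_theorem_of_algebra[of p] by (auto simp: constant_degree)
    then obtain q where q: "p = [:- r, 1:] * q" by (auto simp: poly_eq_0_iff_dvd elim: dvdE)
    have "poly (map_poly const2 [:- r, 1:]) f = f - const2 r"
      by (simp only: c.poly_map_poly_pCons c.minus c.one map_poly_0 poly_0) simp
    moreover have "f - const2 r \<noteq> 0" using f_nonconst by auto
    moreover have "poly (map_poly const2 p) f = 0" using less.prems by (simp add: \<sigma>_inner)
    ultimately have "\<sigma> [:q:] = 0" unfolding q \<rho>.mult by (simp add: \<sigma>_inner)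
    moreover have "degree q < degree p"
      using False unfolding q by (cases "q = 0") (simp_all add: degree_mult_eq del: mult_pCons_left)
    ultimately have "q = 0" using less.hyps by blast
    with q show ?thesis by simp
  qed
qed

text \<open>
  The algebraic independence of \<open>f\<close> and \<open>s\<close>: applying \<open>D\<close> lowers the degree in \<open>s\<close> of a relation,
  and \<open>f\<close> alone is transcendental because \<open>\<complex>\<close> is algebraically closed.
\<close>
lemma \<sigma>_eq_0: "\<sigma> P = 0 \<Longrightarrow> P = 0"
proof (induction "degree P" arbitrary: P rule: less_induct)
  case less
  have "degree P = 0"
  proof (rule ccontr)
    assume "degree P \<noteq> 0"
    moreover have "\<sigma> (pderiv P) = 0" using D_\<sigma>[of P] less.prems by (simp add: D.zero)
    ultimately have "pderiv P = 0" using less.hyps[of "pderiv P"] by (simp add: degree_pderiv)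
    with \<open>degree P \<noteq> 0\<close> show False by (simp add: pderiv_eq_0_iff)
  qed
  then obtain p where "P = [:p:]" by (rule degree_eq_zeroE)
  with less.prems \<sigma>_inner_eq_0 show ?case by simp
qed

text \<open>
  In a polynomial relation for \<open>g\<close> over \<open>\<complex>[f, s]\<close>, cancel powers of \<open>g\<close> until the constant term \<open>u\<close>
  is nonzero; then \<open>g\<close> divides it.
\<close>
lemma multiple_in_base:
  assumes "g \<noteq> 0"
  obtains h u where "u \<noteq> 0" "g * h = \<sigma> u"
proof -
  have "\<exists>h u. u \<noteq> 0 \<and> g * h = \<sigma> u" if "P \<noteq> 0" "poly (map_poly \<sigma> P) g = 0" for P
    using that
  proof (induction P)
    case (pCons a P)
    from pCons.prems have eq: "\<sigma> a + g * poly (map_poly \<sigma> P) g = 0"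
      by (simp only: \<sigma>.poly_map_poly_pCons)
    show ?case
    proof (cases "a = 0")
      case True
      with eq assms pCons show ?thesis by (simp add: \<sigma>.zero)
    next
      case False
      from eq have "g * (- poly (map_poly \<sigma> P) g) = \<sigma> a" by (simp add: add_eq_0_iff)
      with False show ?thesis by blast
    qed
  qed simp
  moreover obtain P where "P \<noteq> 0" "poly (map_poly \<sigma> P) g = 0" by (rule algebraic_relation)
  ultimately obtain h u where "u \<noteq> 0" "g * h = \<sigma> u" by blast
  then show ?thesis by (rule that)
qed

text \<open>
  Both variables are algebraic over \<open>\<complex>(f, s)\<close>, so finitely many monomials \<open>x\<^sub>1\<^sup>i x\<^sub>2\<^sup>j\<close> span all
  polynomials over that field.
\<close>
lemma finite_over_base:
  fixes \<iota> :: "cpoly2 fract \<Rightarrow> cpoly2 fract"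
  assumes \<iota>: "ring_morphism \<iota>" "\<And>a b. b \<noteq> 0 \<Longrightarrow> \<iota> (Fract a b) = Fract (\<sigma> a) (\<sigma> b)"
  obtains G where "finite G" "\<And>g. Fract g 1 \<in> module.span (\<lambda>c v. \<iota> c * v) ((\<lambda>g. Fract g 1) ` G)"
proof -
  interpret \<iota>: ring_morphism \<iota> by fact
  interpret vector_space "\<lambda>c v. \<iota> c * v"
    by unfold_locales (simp_all add: \<iota>.add \<iota>.mult \<iota>.one algebra_simps)
  define em where "em = (\<lambda>g::cpoly2. Fract g 1)"
  interpret em: ring_morphism em
    by unfold_locales (simp_all add: em_def One_fract_def)
  have em_\<sigma>: "em (\<sigma> u) = \<iota> (Fract u 1)" for u
    by (simp add: em_def \<iota>(2) \<sigma>.one)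
  have rel: "\<exists>N c. em x ^ N = (\<Sum>i<N. \<iota> (c i) * em x ^ i)" for x
  proof -
    obtain P where P: "P \<noteq> 0" "poly (map_poly \<sigma> P) x = 0" by (rule algebraic_relation)
    define N where "N = degree P"
    define l where "l = coeff P N"
    have l: "l \<noteq> 0" using P(1) by (simp add: l_def N_def)
    then have l': "\<iota> (Fract l 1) \<noteq> 0"
      using \<sigma>_eq_0[of l] by (auto simp: em_def eq_fract Zero_fract_def simp flip: em_\<sigma>)
    have "poly (map_poly \<sigma> P) x = (\<Sum>i\<le>N. \<sigma> (coeff P i) * x ^ i)"
      by (rule \<sigma>.poly_map_poly_altdef) (simp add: N_def)
    with P(2) have "em (\<Sum>i\<le>N. \<sigma> (coeff P i) * x ^ i) = 0" by (simp add: em.zero)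
    then have "(\<Sum>i<N. \<iota> (Fract (coeff P i) 1) * em x ^ i) + \<iota> (Fract l 1) * em x ^ N = 0"
      unfolding em.sum em.mult em.power em_\<sigma> by (simp add: l_def flip: lessThan_Suc_atMost)
    then have eq: "\<iota> (Fract l 1) * em x ^ N = - (\<Sum>i<N. \<iota> (Fract (coeff P i) 1) * em x ^ i)"
      by (simp only: add_eq_0_iff)
    obtain k where k: "\<iota> k * \<iota> (Fract l 1) = 1"
    proof
      have "Fract l 1 \<noteq> 0" using l' \<iota>.zero by auto
      then show "\<iota> (inverse (Fract l 1)) * \<iota> (Fract l 1) = 1"
        unfolding \<iota>.mult[symmetric] by (subst left_inverse) (auto simp: \<iota>.one)
    qed
    have "em x ^ N = \<iota> k * \<iota> (Fract l 1) * em x ^ N" by (simp only: k mult_1)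
    also have "\<dots> = \<iota> k * - (\<Sum>i<N. \<iota> (Fract (coeff P i) 1) * em x ^ i)"
      by (simp only: mult.assoc eq)
    also have "\<dots> = (\<Sum>i<N. \<iota> (- k * Fract (coeff P i) 1) * em x ^ i)"
      by (simp only: sum_distrib_left sum_negf[symmetric] \<iota>.mult \<iota>.minus mult.assoc
          mult_minus_left mult_minus_right)
    finally show ?thesis by (intro exI)
  qed
  obtain N1 c1 where r1: "em X1 ^ N1 = (\<Sum>i<N1. \<iota> (c1 i) * em X1 ^ i)" using rel by blast
  obtain N2 c2 where r2: "em X2 ^ N2 = (\<Sum>i<N2. \<iota> (c2 i) * em X2 ^ i)" using rel by blast
  define G where "G = (\<lambda>(i, j). X1 ^ i * X2 ^ j) ` ({..N1} \<times> {..N2})"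
  define V where "V = span (em ` G)"
  have gen: "em X1 ^ i * em X2 ^ j \<in> V" if "i \<le> N1" "j \<le> N2" for i j
    unfolding V_def using that by (intro span_base) (auto simp: G_def em.mult em.power image_iff)
  have mult_closed: "em x * v \<in> V" if "v \<in> V" "\<And>i j. i \<le> N1 \<Longrightarrow> j \<le> N2 \<Longrightarrow> em x * (em X1 ^ i * em X2 ^ j) \<in> V" for x v
    using that(1) unfolding V_def
  proof (induction v rule: span_induct_alt)
    case base
    show ?case by (simp add: span_zero)
  next
    case (step c b v)
    from step(1) obtain i j where "i \<le> N1" "j \<le> N2" "b = em X1 ^ i * em X2 ^ j"
      by (auto simp: G_def em.mult em.power)
    with that(2) have "em x * b \<in> span (em ` G)" by (simp add: V_def)
    then have "\<iota> c * (em x * b) + em x * v \<in> span (em ` G)"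
      by (intro span_add span_scale step)
    then show ?case by (simp add: distrib_left mult.left_commute)
  qed
  have X1_closed: "em X1 * v \<in> V" if "v \<in> V" for v
  proof (rule mult_closed[OF that])
    fix i j assume ij: "i \<le> N1" "j \<le> N2"
    show "em X1 * (em X1 ^ i * em X2 ^ j) \<in> V"
    proof (cases "i < N1")
      case True
      with gen[of "Suc i" j] ij show ?thesis by (simp add: mult.assoc)
    next
      case False
      with ij have "i = N1" by simp
      then have "em X1 * (em X1 ^ i * em X2 ^ j) = (\<Sum>k<N1. \<iota> (c1 k) * (em X1 ^ Suc k * em X2 ^ j))"
        by (simp add: r1 sum_distrib_left sum_distrib_right mult_ac)
      also have "\<dots> \<in> V"
        using ij gen unfolding V_def by (intro span_sum span_scale) (simp del: power_Suc)
      finally show ?thesis .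
    qed
  qed
  have X2_closed: "em X2 * v \<in> V" if "v \<in> V" for v
  proof (rule mult_closed[OF that])
    fix i j assume ij: "i \<le> N1" "j \<le> N2"
    show "em X2 * (em X1 ^ i * em X2 ^ j) \<in> V"
    proof (cases "j < N2")
      case True
      with gen[of i "Suc j"] ij show ?thesis by (simp add: mult_ac)
    next
      case False
      with ij have "j = N2" by simp
      then have "em X2 * (em X1 ^ i * em X2 ^ j) = (\<Sum>k<N2. \<iota> (c2 k) * (em X1 ^ i * em X2 ^ Suc k))"
        by (simp add: r2 sum_distrib_left sum_distrib_right mult_ac)
      also have "\<dots> \<in> V"
        using ij gen unfolding V_def by (intro span_sum span_scale) (simp del: power_Suc)
      finally show ?thesis .
    qed
  qed
  have "\<forall>v\<in>V. em g * v \<in> V" for g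
  proof (induction g rule: cpoly2_induct)
    case (const c)
    have "em (const2 c) = \<iota> (Fract (const2 c) 1)"
      using em_\<sigma>[of "const2 c"] by (simp add: subst2_generators)
    then show ?case by (simp add: V_def span_scale)
  next
    case (add g h)
    then show ?case by (simp add: em.add distrib_right V_def span_add)
  next
    case (mult g h)
    then show ?case by (simp add: em.mult mult.assoc)
  qed (use X1_closed X2_closed in auto)
  moreover have "1 \<in> V" using gen[of 0 0] by simp
  ultimately have "em g \<in> V" for g by (metis mult.right_neutral)
  moreover have "finite G" by (simp add: G_def)
  ultimately show ?thesis using that unfolding V_def em_def by blast
qed

section \<open>The trace to the base and a monic differential equation\<close>
text \<open>
  The field \<open>\<complex>(f, s)\<close> is represented as the fraction field of polynomials in two formal variables,
  and \<open>Tr\<close> is the trace of multiplication on the span of \<open>B\<close> over that field. Nondegeneracy comes from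
  \<open>multiple_in_base\<close>: if \<open>g \<noteq> 0\<close>, some multiple of \<open>g\<close> is a nonzero element of the base, whose trace is
  that element times the dimension.
\<close>
lemma trace_to_base:
  "\<exists>(Tr :: cpoly2 \<Rightarrow> cpoly2 fract) G.
     (\<forall>g h. Tr (g + h) = Tr g + Tr h) \<and> (\<forall>u g. Tr (\<sigma> u * g) = Fract u 1 * Tr g) \<and>
     (\<forall>g. \<exists>\<alpha> \<beta>. \<beta> \<noteq> 0 \<and> Tr (D g) = Fract (pderiv \<alpha> * \<beta> - \<alpha> * pderiv \<beta>) (\<beta>\<^sup>2)) \<and>
     finite G \<and> (\<forall>g. (\<forall>b\<in>G. Tr (g * b) = 0) \<longrightarrow> g = 0)"
proof -
  obtain \<iota> :: "cpoly2 fract \<Rightarrow> cpoly2 fract"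
    where \<iota>: "ring_morphism \<iota>" "\<And>a b. b \<noteq> 0 \<Longrightarrow> \<iota> (Fract a b) = Fract (\<sigma> a) (\<sigma> b)"
    using ring_morphism_fract[OF ring_morphism_subst2[of f s] \<sigma>_eq_0] by blast
  obtain \<delta> :: "cpoly2 fract \<Rightarrow> cpoly2 fract"
    where \<delta>: "derivation \<delta>" "\<And>a b. b \<noteq> 0 \<Longrightarrow> \<delta> (Fract a b) = Fract (D a * b - a * D b) (b * b)"
    using derivation_fract[OF D.derivation_axioms] by blast
  obtain \<epsilon> :: "cpoly2 fract \<Rightarrow> cpoly2 fract"
    where \<epsilon>: "derivation \<epsilon>" "\<And>a b. b \<noteq> 0 \<Longrightarrow> \<epsilon> (Fract a b) = Fract (pderiv a * b - a * pderiv b) (b * b)"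
    using derivation_fract[OF derivation2_derivation[OF derivation2_pderiv]] by blast
  interpret \<iota>: ring_morphism \<iota> by fact
  interpret \<delta>: derivation \<delta> by fact
  interpret vector_space "\<lambda>c v. \<iota> c * v"
    by unfold_locales (simp_all add: \<iota>.add \<iota>.mult \<iota>.one algebra_simps)
  define em where "em = (\<lambda>g::cpoly2. Fract g 1)"
  interpret em: ring_morphism em
    by unfold_locales (simp_all add: em_def One_fract_def)
  have em_\<sigma>: "em (\<sigma> u) = \<iota> (Fract u 1)" for u
    by (simp add: em_def \<iota>(2) \<sigma>.one)
  have em_D: "\<delta> (em g) = em (D g)" for g
    by (simp add: em_def \<delta>(2) D.one)
  have compat: "\<delta> (\<iota> c) = \<iota> (\<epsilon> c)" for c
  proof -
    obtain a b where c: "c = Fract a b" "b \<noteq> 0" by (cases c)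
    with \<sigma>_eq_0 have "\<sigma> b \<noteq> 0" by blast
    with c show ?thesis by (simp add: \<iota>(2) \<delta>(2) \<epsilon>(2) D_\<sigma> \<sigma>.diff \<sigma>.mult)
  qed
  obtain G where G: "finite G" "\<And>g. em g \<in> span (em ` G)"
    using finite_over_base[OF \<iota>] unfolding em_def by blast
  define V where "V = span (em ` G)"
  have V: "em g \<in> V" for g using G(2) by (simp add: V_def)
  have Vmult: "v * w \<in> V" if "v \<in> V" "w \<in> V" for v w
    using that(1) unfolding V_def
  proof (induction v rule: span_induct_alt)
    case base
    show ?case by (simp add: span_zero)
  next
    case (step c x v)
    then obtain g where g: "x = em g" by auto
    have "x * w \<in> span (em ` G)"
      using that(2) unfolding V_def
    proof (induction w rule: span_induct_alt)
      case base
      show ?case by (simp add: span_zero)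
    next
      case (step c y w)
      then obtain h where "y = em h" by auto
      then have "x * y = em (g * h)" by (simp add: g em.mult)
      then have "\<iota> c * (x * y) + x * w \<in> span (em ` G)"
        using V step by (intro span_add span_scale) (simp_all add: V_def)
      then show ?case by (simp add: distrib_left mult.left_commute)
    qed
    then have "\<iota> c * (x * w) + v * w \<in> span (em ` G)"
      by (intro span_add span_scale step)
    then show ?case by (simp add: distrib_right mult.assoc)
  qed
  have V\<delta>: "\<delta> v \<in> V" if "v \<in> V" for v
    using that unfolding V_def
  proof (induction v rule: span_induct_alt)
    case base
    show ?case by (simp add: span_zero \<delta>.zero)
  next
    case (step c x v)
    then obtain g where g: "x = em g" by auto
    have "\<delta> (\<iota> c * x + v) = \<iota> c * em (D g) + \<iota> (\<epsilon> c) * em g + \<delta> v"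
      by (simp add: g \<delta>.add \<delta>.mult compat em_D)
    also have "\<dots> \<in> span (em ` G)"
      using V unfolding V_def by (intro span_add span_scale step)
    finally show ?case .
  qed
  have one: "1 \<in> V" using V[of 1] by (simp only: em.one)
  obtain tr n where tr: "\<And>v w. v \<in> V \<Longrightarrow> w \<in> V \<Longrightarrow> tr (v + w) = tr v + tr w"
    "\<And>c v. v \<in> V \<Longrightarrow> tr (\<iota> c * v) = c * tr v" "tr 1 = of_nat n" "n > 0"
    "\<And>v. v \<in> V \<Longrightarrow> tr (\<delta> v) = \<epsilon> (tr v)"
  proof (rule horizontal_trace_exists[OF \<iota>(1) \<delta>(1) \<epsilon>(1) compat V_def finite_imageI[OF G(1)] one Vmult V\<delta>])
    fix tr n
    assume "\<And>v w. v \<in> V \<Longrightarrow> w \<in> V \<Longrightarrow> tr (v + w) = tr v + tr w"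
      "\<And>c v. v \<in> V \<Longrightarrow> tr (\<iota> c * v) = c * tr v" "tr 1 = of_nat n" "n > 0"
      "\<And>v. v \<in> V \<Longrightarrow> tr (\<delta> v) = \<epsilon> (tr v)"
    then show thesis by (rule that)
  qed assumption+
  define Tr where "Tr = (\<lambda>g. tr (em g))"
  have Tr_add: "Tr (g + h) = Tr g + Tr h" for g h
    by (simp add: Tr_def em.add tr(1) V)
  have Tr_mult: "Tr (\<sigma> u * g) = Fract u 1 * Tr g" for u g
    by (simp add: Tr_def em.mult em_\<sigma> tr(2) V)
  have Tr_D: "\<exists>\<alpha> \<beta>. \<beta> \<noteq> 0 \<and> Tr (D g) = Fract (pderiv \<alpha> * \<beta> - \<alpha> * pderiv \<beta>) (\<beta>\<^sup>2)" for g
  proof -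
    obtain \<alpha> \<beta> where ab: "Tr g = Fract \<alpha> \<beta>" "\<beta> \<noteq> 0" by (cases "Tr g")
    have "Tr (D g) = \<epsilon> (Tr g)" by (simp add: Tr_def tr(5) V flip: em_D)
    with ab show ?thesis by (auto simp: \<epsilon>(2) power2_eq_square)
  qed
  have nondeg: "g = 0" if zero: "\<And>b. b \<in> G \<Longrightarrow> Tr (g * b) = 0" for g
  proof (rule ccontr)
    assume "g \<noteq> 0"
    then obtain h u where hu: "u \<noteq> 0" "g * h = \<sigma> u" by (rule multiple_in_base)
    have "em g * v \<in> V \<and> tr (em g * v) = 0" if "v \<in> V" for v
      using that unfolding V_def
    proof (induction v rule: span_induct_alt)
      case base
      have "tr (\<iota> 0 * 1) = 0" using tr(2)[of 1 0] V[of 1] by (simp add: em.one)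
      then show ?case by (simp add: span_zero \<iota>.zero)
    next
      case (step c x v)
      then obtain b where b: "b \<in> G" "x = em b" by auto
      have x: "em g * x \<in> V" "tr (em g * x) = 0"
        using V[of "g * b"] zero[OF b(1)] by (simp_all add: b em.mult Tr_def)
      have eq: "em g * (\<iota> c * x + v) = \<iota> c * (em g * x) + em g * v"
        by (simp add: algebra_simps)
      have cx: "\<iota> c * (em g * x) \<in> V" using x(1) unfolding V_def by (rule span_scale)
      with step.IH have "\<iota> c * (em g * x) + em g * v \<in> V" unfolding V_def by (blast intro: span_add)
      moreover have "tr (\<iota> c * (em g * x) + em g * v) = 0"
        using step.IH x cx by (simp add: tr(1,2) V_def)
      ultimately show ?case unfolding eq V_def by blast
    qed
    then have "tr (em (g * h)) = 0" using V[of h] by (simp add: em.mult)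
    then have "Fract u 1 * of_nat n = 0"
      using tr(2)[of 1 "Fract u 1"] V[of 1] tr(3) by (simp add: hu em_\<sigma> em.one)
    moreover have "of_nat n \<noteq> (0::cpoly2 fract)" using tr(4) by (simp add: of_nat_fract eq_fract Zero_fract_def)
    ultimately have "Fract u 1 = 0" by (simp only: mult_eq_0_iff) blast
    with hu(1) show False by (simp add: eq_fract Zero_fract_def)
  qed
  show ?thesis
    by (intro exI[of _ Tr] exI[of _ G] conjI allI impI Tr_add Tr_mult Tr_D G(1) nondeg) blast
qed

text \<open>
  Surjectivity of \<open>D\<close> makes every trace a derivative, so all traces have denominators in \<open>\<complex>[f]\<close> only.
  The vectors of traces \<open>Tr (D\<^sup>k g \<cdot> b)\<close>, with \<open>b\<close> from a finite set detecting zero, become polynomial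
  vectors after scaling by suitable \<open>A k \<in> \<complex>[f]\<close>. Some one of them depends on its predecessors, and
  by nondegeneracy so does \<open>D\<^sup>N g\<close>. The point is that the leading coefficient \<open>a(f)\<close> does not
  involve \<open>s\<close>: along a trajectory of \<open>D\<close> it is constant.
\<close>
lemma monic_differential_equation:
  assumes surj: "surj D"
  shows "\<exists>N a c. a \<noteq> 0 \<and> \<sigma> [:a:] * (D ^^ N) g = (\<Sum>i<N. \<sigma> (c i) * (D ^^ i) g)"
proof -
  obtain Tr :: "cpoly2 \<Rightarrow> cpoly2 fract" and G
    where T: "(\<forall>g h. Tr (g + h) = Tr g + Tr h) \<and> (\<forall>u g. Tr (\<sigma> u * g) = Fract u 1 * Tr g) \<and>
      (\<forall>g. \<exists>\<alpha> \<beta>. \<beta> \<noteq> 0 \<and> Tr (D g) = Fract (pderiv \<alpha> * \<beta> - \<alpha> * pderiv \<beta>) (\<beta>\<^sup>2)) \<and>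
      finite G \<and> (\<forall>g. (\<forall>b\<in>G. Tr (g * b) = 0) \<longrightarrow> g = 0)"
    using trace_to_base by (elim exE) (rule that)
  have Tr_add: "Tr (g + h) = Tr g + Tr h" for g h using T by blast
  have Tr_D: "\<exists>\<alpha> \<beta>. \<beta> \<noteq> 0 \<and> Tr (D g) = Fract (pderiv \<alpha> * \<beta> - \<alpha> * pderiv \<beta>) (\<beta>\<^sup>2)" for g
    using T by blast
  have G: "finite G" using T by blast
  have nondeg: "g = 0" if "\<And>b. b \<in> G \<Longrightarrow> Tr (g * b) = 0" for g using T that by blast
  define em where "em = (\<lambda>u::cpoly2. Fract u 1)"
  interpret em: ring_morphism em
    by unfold_locales (simp_all add: em_def One_fract_def)
  have Tr_mult: "Tr (\<sigma> u * g) = em u * Tr g" for u g using T by (simp add: em_def)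
  have Tr_0: "Tr 0 = 0" using Tr_mult[of 0 0] by (simp add: em.zero)
  have Tr_sum: "Tr (\<Sum>i\<in>I. F i) = (\<Sum>i\<in>I. Tr (F i))" for F and I :: "nat set"
    by (induction I rule: infinite_finite_induct) (simp_all add: Tr_0 Tr_add)
  have integral: "\<exists>a r. a \<noteq> 0 \<and> em [:a:] * Tr h = em r" for h
  proof -
    obtain p q where pq: "Tr h = Fract p q" "q \<noteq> 0" by (cases "Tr h")
    have "\<exists>\<alpha> \<beta>. \<beta> \<noteq> 0 \<and> u * p * \<beta>\<^sup>2 = q * (pderiv \<alpha> * \<beta> - \<alpha> * pderiv \<beta>)" for u
    proof -
      obtain k where "\<sigma> u * h = D k" using surjD[OF surj] by blast
      with Tr_D[of k] obtain \<alpha> \<beta> where ab: "\<beta> \<noteq> 0"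
        "Tr (\<sigma> u * h) = Fract (pderiv \<alpha> * \<beta> - \<alpha> * pderiv \<beta>) (\<beta>\<^sup>2)" by auto
      then have "Fract (u * p) q = Fract (pderiv \<alpha> * \<beta> - \<alpha> * pderiv \<beta>) (\<beta>\<^sup>2)"
        by (simp add: Tr_mult pq em_def)
      with ab(1) pq(2) have "u * p * \<beta>\<^sup>2 = q * (pderiv \<alpha> * \<beta> - \<alpha> * pderiv \<beta>)"
        by (simp add: eq_fract mult.commute)
      with ab(1) show ?thesis by blast
    qed
    from denominator_free_if_multiples_derivatives[OF pq(2) this] obtain a r where "a \<noteq> 0" "smult a p = q * r"
      by blast
    with pq show ?thesis by (intro exI[of _ a] exI[of _ r]) (simp add: em_def eq_fract mult.commute)
  qed
  have common: "\<exists>a r. a \<noteq> 0 \<and> (\<forall>b\<in>G'. em [:a:] * Tr (h * b) = em (r b))" if "finite G'" for h G'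
    using that
  proof (induction G' rule: finite_induct)
    case empty
    show ?case by (intro exI[of _ 1]) simp
  next
    case (insert b G')
    then obtain a r where ar: "a \<noteq> 0" "\<And>b. b \<in> G' \<Longrightarrow> em [:a:] * Tr (h * b) = em (r b)" by blast
    obtain a' r' where ar': "a' \<noteq> 0" "em [:a':] * Tr (h * b) = em r'" using integral by blast
    have "em [:a * a':] = em [:a:] * em [:a':]" by (simp add: mult.commute flip: em.mult)
    then have mult: "em [:a * a':] * x = em [:a':] * (em [:a:] * x)" "em [:a * a':] * x = em [:a:] * (em [:a':] * x)" for x
      by (simp_all only: mult_ac)
    have "em [:a * a':] * Tr (h * b') = em (if b' = b then [:a:] * r' else [:a':] * r b')" if "b' \<in> insert b G'" for b'
    proof (cases "b' = b")
      case True
      then show ?thesis by (simp only: mult(2) ar'(2) em.mult simp_thms if_True)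
    next
      case False
      with that have "b' \<in> G'" by blast
      with False show ?thesis by (simp only: mult(1) ar(2) em.mult if_False)
    qed
    with ar(1) ar'(1) show ?case
      by (intro exI[of _ "a * a'"] exI[of _ "\<lambda>b'. if b' = b then [:a:] * r' else [:a':] * r b'"]) auto
  qed
  have "\<forall>k. \<exists>a r. a \<noteq> 0 \<and> (\<forall>b\<in>G. em [:a:] * Tr ((D ^^ k) g * b) = em (r b))"
    using common[OF G] by blast
  then obtain A r where A: "\<And>k. A k \<noteq> 0"
    and r: "\<And>k b. b \<in> G \<Longrightarrow> em [:A k:] * Tr ((D ^^ k) g * b) = em (r k b)"
    by metis
  obtain n b where b: "G = b ` {i::nat. i < n}"
    using G by (auto simp: finite_conv_nat_seg_image)
  define v where "v = (\<lambda>k i. if i < n then r k (b i) else 0)"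
  have "\<exists>N a c. a \<noteq> 0 \<and> (\<forall>i. smult a (v N i) = (\<Sum>k<N. c k * v k i))"
    by (rule eventually_dependent_on_predecessors[of n]) (simp add: v_def)
  then obtain N a c where ac: "a \<noteq> 0" "\<And>i. smult a (v N i) = (\<Sum>k<N. c k * v k i)"
    by blast
  have "\<sigma> [:a * A N:] * (D ^^ N) g + (\<Sum>k<N. \<sigma> (- (c k * [:A k:])) * (D ^^ k) g) = 0"
  proof (rule nondeg)
    fix x assume "x \<in> G"
    then obtain i where i: "i < n" "x = b i" using b by auto
    then have x: "em [:A k:] * Tr ((D ^^ k) g * x) = em (v k i)" for k
      using r[OF \<open>x \<in> G\<close>] by (simp add: v_def)
    have "Tr ((\<sigma> [:a * A N:] * (D ^^ N) g + (\<Sum>k<N. \<sigma> (- (c k * [:A k:])) * (D ^^ k) g)) * x) =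
        em [:a * A N:] * Tr ((D ^^ N) g * x) + (\<Sum>k<N. em (- (c k * [:A k:])) * Tr ((D ^^ k) g * x))"
      by (simp only: distrib_right sum_distrib_right mult.assoc Tr_add Tr_sum Tr_mult)
    also have "em [:a * A N:] = em [:a:] * em [:A N:]" by (simp add: mult.commute flip: em.mult)
    also have "\<dots> * Tr ((D ^^ N) g * x) = em (smult a (v N i))"
      unfolding mult.assoc x by (simp flip: em.mult)
    also have "(\<Sum>k<N. em (- (c k * [:A k:])) * Tr ((D ^^ k) g * x)) = em (- (\<Sum>k<N. c k * v k i))"
      by (simp only: em.minus em.mult em.sum mult.assoc x mult_minus_left sum_negf)
    finally show "Tr ((\<sigma> [:a * A N:] * (D ^^ N) g + (\<Sum>k<N. \<sigma> (- (c k * [:A k:])) * (D ^^ k) g)) * x) = 0"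
      by (simp only: ac(2) em.minus) simp
  qed
  then have "\<sigma> [:a * A N:] * (D ^^ N) g = (\<Sum>k<N. \<sigma> (c k * [:A k:]) * (D ^^ k) g)"
    by (simp only: \<sigma>.minus mult_minus_left sum_negf) simp
  moreover have "a * A N \<noteq> 0" using ac(1) A[of N] by simp
  ultimately show ?thesis by (intro exI conjI)
qed

end

section \<open>Entire solutions of linear differential equations\<close>

text \<open>
  If each coefficient is bounded by \<open>C / n\<close> times the largest of the last \<open>d + 1\<close> coefficients, then
  for any \<open>\<epsilon> > 0\<close> the factor \<open>C / n\<close> is eventually below \<open>\<epsilon>\<^bsup>d+1\<^esup>\<close>, so the coefficients decay at
  least like \<open>\<epsilon>\<^sup>n\<close>.
\<close>
lemma fps_conv_radius_recurrence:
  fixes h :: "nat \<Rightarrow> complex"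
  assumes "\<And>n M. n \<ge> n0 \<Longrightarrow> (\<And>k. k \<le> n \<Longrightarrow> n \<le> k + d \<Longrightarrow> norm (h k) \<le> M) \<Longrightarrow>
    norm (h (Suc n)) \<le> C / real (Suc n) * M"
  shows "fps_conv_radius (Abs_fps h) = \<infinity>"
proof -
  have bound: "\<exists>B. \<forall>n. norm (h n) \<le> B * \<epsilon> ^ n" if \<epsilon>: "0 < \<epsilon>" "\<epsilon> \<le> 1" for \<epsilon> :: real
  proof -
    obtain m where m: "C / \<epsilon> ^ Suc d < real m" using reals_Archimedean2 by blast
    define n1 where "n1 = max n0 m"
    define B where "B = (\<Sum>k\<le>n1. norm (h k) / \<epsilon> ^ k)"
    have B: "B \<ge> 0" unfolding B_def using \<epsilon> by (intro sum_nonneg) simp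
    have "norm (h n) \<le> B * \<epsilon> ^ n" for n
    proof (induction n rule: less_induct)
      case (less n)
      show ?case
      proof (cases "n \<le> n1")
        case True
        have "norm (h n) / \<epsilon> ^ n \<le> B"
          unfolding B_def by (rule member_le_sum) (use True \<epsilon> in auto)
        then show ?thesis using \<epsilon> by (simp add: pos_divide_le_eq)
      next
        case False
        then obtain p where p: "n = Suc p" "p \<ge> n1" by (cases n) auto
        have "norm (h (Suc p)) \<le> C / real (Suc p) * (B * \<epsilon> ^ (p - d))"
        proof (rule assms)
          show "p \<ge> n0" using p(2) by (simp add: n1_def)
          fix k assume k: "k \<le> p" "p \<le> k + d"
          have "norm (h k) \<le> B * \<epsilon> ^ k" using less.IH[of k] k p by simp
          also have "\<dots> \<le> B * \<epsilon> ^ (p - d)"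
            using \<epsilon> B k by (intro mult_left_mono power_decreasing) auto
          finally show "norm (h k) \<le> B * \<epsilon> ^ (p - d)" .
        qed
        also have "C / real (Suc p) \<le> \<epsilon> ^ Suc d"
        proof -
          have "C / \<epsilon> ^ Suc d \<le> real (Suc p)" using m p(2) by (simp add: n1_def)
          then show ?thesis using \<epsilon> by (simp add: field_simps)
        qed
        then have "C / real (Suc p) * (B * \<epsilon> ^ (p - d)) \<le> \<epsilon> ^ Suc d * (B * \<epsilon> ^ (p - d))"
          using B \<epsilon> by (intro mult_right_mono) auto
        also have "\<dots> = B * \<epsilon> ^ (Suc d + (p - d))" by (simp add: power_add)
        \<comment> \<open>Truncated subtraction is harmless: \<open>p < d\<close> gives \<open>\<epsilon>\<^bsup>d+1\<^esup> \<le> \<epsilon>\<^bsup>p+1\<^esup>\<close> since \<open>\<epsilon> \<le> 1\<close>.\<close>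
        also have "\<dots> \<le> B * \<epsilon> ^ Suc p" using B \<epsilon> by (intro mult_left_mono power_decreasing) auto
        finally show ?thesis by (simp add: p(1))
      qed
    qed
    then show ?thesis by blast
  qed
  have "summable (\<lambda>n. h n * z ^ n)" for z
  proof -
    define \<epsilon> where "\<epsilon> = 1 / (1 + norm z)"
    have pos: "1 + norm z > 0" by (rule add_pos_nonneg) simp_all
    have \<epsilon>: "0 < \<epsilon>" "\<epsilon> \<le> 1" "\<epsilon> * norm z < 1" using pos by (simp_all add: \<epsilon>_def)
    obtain B where B: "\<And>n. norm (h n) \<le> B * \<epsilon> ^ n" using bound[OF \<epsilon>(1,2)] by blast
    show ?thesis
    proof (rule summable_comparison_test)
      show "summable (\<lambda>n. B * (\<epsilon> * norm z) ^ n)"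
        using \<epsilon> by (intro summable_mult summable_geometric) simp
      show "\<exists>N. \<forall>n\<ge>N. norm (h n * z ^ n) \<le> B * (\<epsilon> * norm z) ^ n"
        using B by (auto simp: norm_mult norm_power power_mult_distrib mult.assoc[symmetric] intro!: mult_right_mono)
    qed
  qed
  then show ?thesis by (simp add: fps_conv_radius_def conv_radius_inftyI'')
qed

lemma fps_nth_higher_deriv:
  fixes H :: "complex fps"
  shows "fps_nth ((fps_deriv ^^ i) H) m = of_nat (pochhammer (Suc m) i) * fps_nth H (m + i)"
proof (induction i arbitrary: m)
  case (Suc i)
  have "fps_nth ((fps_deriv ^^ Suc i) H) m = of_nat (Suc m) * fps_nth ((fps_deriv ^^ i) H) (Suc m)"
    by simp
  also have "\<dots> = of_nat (pochhammer (Suc m) (Suc i)) * fps_nth H (m + Suc i)"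
    by (simp only: Suc.IH pochhammer_rec of_nat_mult mult.assoc) simp
  finally show ?case .
qed simp

lemma pochhammer_ratio_le:
  assumes "i < N" "j \<le> m"
  shows "real (m + N) * real (pochhammer (Suc (m - j)) i) \<le> real (pochhammer (Suc m) N)"
proof -
  obtain N' where N': "N = Suc N'" using assms(1) by (cases N) auto
  have "pochhammer (Suc (m - j)) i \<le> pochhammer (Suc m) i"
    unfolding pochhammer_prod by (rule prod_mono) auto
  also have "\<dots> \<le> pochhammer (Suc m) N'"
  proof -
    obtain k where "N' = i + k" using assms(1) N' less_eq_Suc_le by (metis Suc_le_mono le_Suc_ex)
    then show ?thesis by (simp add: pochhammer_product' pochhammer_pos Suc_le_eq)
  qed
  finally have "(m + N) * pochhammer (Suc (m - j)) i \<le> (m + N) * pochhammer (Suc m) N'" by simp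
  also have "\<dots> = pochhammer (Suc m) N" by (simp add: N' pochhammer_rec')
  finally show ?thesis by (metis of_nat_le_iff of_nat_mult)
qed

text \<open>
  With constant leading coefficient, comparing coefficients of \<open>t\<^sup>m\<close> expresses the coefficient of
  index \<open>m + N\<close> through finitely many predecessors. The rising factorial of length \<open>N\<close> on the left
  beats those of length less than \<open>N\<close> on the right by a factor \<open>m + N\<close>
  (\<open>pochhammer_ratio_le\<close>), which is what \<open>fps_conv_radius_recurrence\<close> needs.
\<close>
lemma entire_solution:
  fixes H :: "complex fps"
  assumes \<alpha>: "\<alpha> \<noteq> 0"
    and ode: "fps_const \<alpha> * (fps_deriv ^^ N) H = (\<Sum>i<N. fps_of_poly (q i) * (fps_deriv ^^ i) H)"
  shows "fps_conv_radius H = \<infinity>"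
proof (cases "N = 0")
  case True
  with ode \<alpha> have "H = 0" by simp
  then show ?thesis by simp
next
  case False
  define h where "h = fps_nth H"
  define e where "e = (\<Sum>i<N. degree (q i))"
  define C where "C = (\<Sum>i<N. \<Sum>j\<le>e. norm (coeff (q i) j)) / norm \<alpha>"
  have deg: "degree (q i) \<le> e" if "i < N" for i
    unfolding e_def using that by (intro member_le_sum) auto
  have "fps_conv_radius (Abs_fps h) = \<infinity>"
  proof (rule fps_conv_radius_recurrence)
    fix n M assume n: "n \<ge> N - 1" and M: "\<And>k. k \<le> n \<Longrightarrow> n \<le> k + (e + N) \<Longrightarrow> norm (h k) \<le> M"
    define m where "m = Suc n - N"
    have mN: "m + N = Suc n" using n False by (simp add: m_def)
    have M0: "M \<ge> 0" using M[of n] norm_ge_zero[of "h n"] by linarith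
    define R where "R = real (pochhammer (Suc m) N)"
    have R: "R > 0" unfolding R_def by (simp add: pochhammer_pos)
    have "fps_nth (fps_const \<alpha> * (fps_deriv ^^ N) H) m =
        (\<Sum>i<N. \<Sum>j\<le>m. coeff (q i) j * (of_nat (pochhammer (Suc (m - j)) i) * h (m - j + i)))"
      unfolding ode by (simp add: fps_sum_nth fps_mult_nth fps_nth_higher_deriv h_def atLeast0AtMost)
    then have eq: "\<alpha> * (of_nat (pochhammer (Suc m) N) * h (Suc n)) =
        (\<Sum>i<N. \<Sum>j\<le>m. coeff (q i) j * (of_nat (pochhammer (Suc (m - j)) i) * h (m - j + i)))"
      by (simp only: fps_mult_left_const_nth fps_nth_higher_deriv h_def mN)
    have summand: "norm (coeff (q i) j * (of_nat (pochhammer (Suc (m - j)) i) * h (m - j + i))) \<le>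
        norm (coeff (q i) j) * (R / real (Suc n) * M)" if ij: "i < N" "j \<le> m" for i j
    proof (cases "coeff (q i) j = 0")
      case False
      then have "j \<le> e" using deg[OF ij(1)] le_degree by fastforce
      then have "norm (h (m - j + i)) \<le> M" using ij mN by (intro M) auto
      moreover have "real (pochhammer (Suc (m - j)) i) \<le> R / real (Suc n)"
        using pochhammer_ratio_le[OF ij] unfolding R_def mN by (simp add: field_simps del: of_nat_Suc)
      ultimately have "real (pochhammer (Suc (m - j)) i) * norm (h (m - j + i)) \<le> R / real (Suc n) * M"
        using R by (intro mult_mono) auto
      from mult_left_mono[OF this norm_ge_zero] show ?thesis
        by (simp only: norm_mult norm_of_nat)
    qed simp
    have "norm \<alpha> * (R * norm (h (Suc n))) = norm (\<alpha> * (of_nat (pochhammer (Suc m) N) * h (Suc n)))"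
      by (simp add: norm_mult R_def del: of_nat_Suc)
    also have "\<dots> \<le> (\<Sum>i<N. \<Sum>j\<le>m. norm (coeff (q i) j) * (R / real (Suc n) * M))"
      unfolding eq by (intro order.trans[OF norm_sum] sum_mono summand) auto
    also have "\<dots> \<le> (\<Sum>i<N. \<Sum>j\<le>e. norm (coeff (q i) j) * (R / real (Suc n) * M))"
    proof (rule sum_mono)
      fix i assume "i \<in> {..<N}"
      with deg have i: "degree (q i) \<le> e" by simp
      have "(\<Sum>j\<le>m. norm (coeff (q i) j) * (R / real (Suc n) * M)) =
          (\<Sum>j\<in>{..m} \<inter> {..e}. norm (coeff (q i) j) * (R / real (Suc n) * M))"
        using i by (intro sum.mono_neutral_right) (auto simp: coeff_eq_0)
      also have "\<dots> \<le> (\<Sum>j\<le>e. norm (coeff (q i) j) * (R / real (Suc n) * M))"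
        using R M0 by (intro sum_mono2) auto
      finally show "(\<Sum>j\<le>m. norm (coeff (q i) j) * (R / real (Suc n) * M)) \<le>
          (\<Sum>j\<le>e. norm (coeff (q i) j) * (R / real (Suc n) * M))" .
    qed
    also have "\<dots> = (\<Sum>i<N. \<Sum>j\<le>e. norm (coeff (q i) j)) * (R / real (Suc n) * M)"
      by (simp only: sum_distrib_right)
    also have "\<dots> = norm \<alpha> * (R * (C / real (Suc n) * M))"
      using \<alpha> by (simp add: C_def del: of_nat_Suc)
    finally have "(norm \<alpha> * R) * norm (h (Suc n)) \<le> (norm \<alpha> * R) * (C / real (Suc n) * M)"
      by (simp only: mult.assoc)
    moreover have "norm \<alpha> * R > 0" using \<alpha> R by simp
    ultimately show "norm (h (Suc n)) \<le> C / real (Suc n) * M" by (rule mult_left_le_imp_le)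
  qed
  then show ?thesis by (simp add: h_def fps_nth_inverse)
qed

lemma fps_conv_radius_infty:
  fixes f g :: "complex fps"
  assumes "fps_conv_radius f = \<infinity>" "fps_conv_radius g = \<infinity>"
  shows "fps_conv_radius (f + g) = \<infinity>" "fps_conv_radius (f * g) = \<infinity>"
  using fps_conv_radius_add[of f g] fps_conv_radius_mult[of f g] assms by simp_all

lemma poly_growth:
  fixes p :: "complex poly"
  assumes "degree p \<le> d"
  shows "\<exists>M\<ge>0. \<forall>z. norm z \<ge> 1 \<longrightarrow> norm (poly p z) \<le> M * norm z ^ d"
proof (intro exI conjI allI impI)
  show "(\<Sum>i\<le>degree p. norm (coeff p i)) \<ge> 0" by (intro sum_nonneg) simp
  fix z :: complex assume z: "norm z \<ge> 1"
  have "norm (poly p z) \<le> (\<Sum>i\<le>degree p. norm (coeff p i) * norm z ^ d)"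
    unfolding poly_altdef
  proof (rule sum_norm_le)
    fix i assume "i \<in> {..degree p}"
    then show "norm (coeff p i * z ^ i) \<le> norm (coeff p i) * norm z ^ d"
      using assms z by (auto simp: norm_mult norm_power intro!: mult_left_mono power_increasing)
  qed
  then show "norm (poly p z) \<le> (\<Sum>i\<le>degree p. norm (coeff p i)) * norm z ^ d"
    by (simp add: sum_distrib_right)
qed

lemma poly_eventually_ge:
  fixes p :: "complex poly"
  assumes "p \<noteq> 0"
  shows "\<exists>\<epsilon>>0. \<exists>r. \<forall>z. norm z \<ge> r \<longrightarrow> norm (poly p z) \<ge> \<epsilon>"
proof -
  obtain a p' where p: "p = pCons a p'" by (cases p)
  show ?thesis
  proof (cases "p' = 0")
    case True
    with p assms have "a \<noteq> 0" by simp
    with p True show ?thesis by (intro exI[of _ "norm a"]) auto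
  next
    case False
    from poly_infinity[OF False, of 1 a] p show ?thesis by (intro exI[of _ 1]) auto
  qed
qed

text \<open>
  An algebraic equation bounds an entire function \<open>F\<close> by a constant multiple of \<open>\<bar>z\<bar>\<^sup>d\<close> for
  large \<open>z\<close>: where \<open>\<bar>F z\<bar> > 1\<close>, divide the equation by \<open>F z\<close> to the power \<open>N - 1\<close>. Liouville's
  theorem then makes \<open>F\<close> a polynomial of degree at most \<open>d\<close>. As \<open>d\<close> depends on the degrees of the
  coefficients only, it is uniform in families of equations.
\<close>
lemma entire_algebraic_imp_polynomial:
  fixes H :: "complex fps"
  assumes entire: "fps_conv_radius H = \<infinity>"
    and eq: "(\<Sum>k\<le>N. fps_of_poly (p k) * H ^ k) = 0"
    and lead: "p N \<noteq> 0" and deg: "\<And>k. k \<le> N \<Longrightarrow> degree (p k) \<le> d" and n: "n > d"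
  shows "fps_nth H n = 0"
proof -
  define F where "F = eval_fps H"
  have hol: "F holomorphic_on UNIV"
    unfolding F_def by (rule holomorphic_on_eval_fps) (simp add: entire)
  have rel: "(\<Sum>k\<le>N. poly (p k) z * F z ^ k) = 0" for z
  proof -
    have power: "fps_conv_radius (H ^ k) = \<infinity>" for k
      using fps_conv_radius_power[of H k] entire by simp
    have "fps_conv_radius (\<Sum>k\<le>K. fps_of_poly (p k) * H ^ k) = \<infinity> \<and>
        eval_fps (\<Sum>k\<le>K. fps_of_poly (p k) * H ^ k) z = (\<Sum>k\<le>K. poly (p k) z * F z ^ k)" for K
      by (induction K)
        (simp_all add: fps_conv_radius_infty power entire eval_fps_add eval_fps_mult eval_fps_power F_def del: power_Suc)
    then show ?thesis using eq by (metis eval_fps_0)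
  qed
  have "\<forall>k\<in>{..N}. \<exists>M\<ge>0. \<forall>z. norm z \<ge> 1 \<longrightarrow> norm (poly (p k) z) \<le> M * norm z ^ d"
    using deg poly_growth by auto
  then obtain M where M: "\<And>k. k \<le> N \<Longrightarrow> M k \<ge> 0"
    "\<And>k z. k \<le> N \<Longrightarrow> norm z \<ge> 1 \<Longrightarrow> norm (poly (p k) z) \<le> M k * norm z ^ d"
    by (metis atMost_iff)
  obtain \<epsilon> r where \<epsilon>: "\<epsilon> > 0" "\<And>z. norm z \<ge> r \<Longrightarrow> norm (poly (p N) z) \<ge> \<epsilon>"
    using poly_eventually_ge[OF lead] by blast
  define S where "S = (\<Sum>k<N. M k)"
  have S: "S \<ge> 0" unfolding S_def using M(1) by (intro sum_nonneg) simp
  have growth: "norm (F z) \<le> (1 + S / \<epsilon>) * norm z ^ d" if z: "norm z \<ge> max 1 r" for z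
  proof (cases "norm (F z) \<le> 1")
    case True
    have "1 * 1 \<le> (1 + S / \<epsilon>) * norm z ^ d"
      using S \<epsilon>(1) z by (intro mult_mono one_le_power) auto
    with True show ?thesis by linarith
  next
    case False
    have "N \<noteq> 0"
    proof
      assume "N = 0"
      with rel[of z] have "poly (p N) z = 0" by simp
      with \<epsilon>(1) \<epsilon>(2)[of z] z show False by simp
    qed
    then obtain K where K: "N = Suc K" by (cases N) auto
    have "poly (p N) z * F z ^ N = - (\<Sum>k<N. poly (p k) z * F z ^ k)"
      using rel[of z] by (simp add: add_eq_0_iff flip: lessThan_Suc_atMost)
    then have "norm (poly (p N) z) * norm (F z) ^ N = norm (\<Sum>k<N. poly (p k) z * F z ^ k)"
      by (metis norm_minus_cancel norm_mult norm_power)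
    also have "\<dots> \<le> (\<Sum>k<N. M k * norm z ^ d * norm (F z) ^ K)"
    proof (rule sum_norm_le)
      fix k assume "k \<in> {..<N}"
      then show "norm (poly (p k) z * F z ^ k) \<le> M k * norm z ^ d * norm (F z) ^ K"
        using M[of k] z K False by (auto simp: norm_mult norm_power intro!: mult_mono power_increasing)
    qed
    also have "\<dots> = S * norm z ^ d * norm (F z) ^ K"
      by (simp add: S_def sum_distrib_right)
    finally have "norm (poly (p N) z) * norm (F z) ^ N \<le> S * norm z ^ d * norm (F z) ^ K" .
    moreover have "\<epsilon> * norm (F z) ^ N \<le> norm (poly (p N) z) * norm (F z) ^ N"
      using \<epsilon>(2)[of z] z by (intro mult_right_mono) auto
    ultimately have "(\<epsilon> * norm (F z)) * norm (F z) ^ K \<le> (S * norm z ^ d) * norm (F z) ^ K"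
      by (simp add: K mult.assoc)
    moreover have "norm (F z) ^ K > 0" using False by (intro zero_less_power) linarith
    ultimately have "\<epsilon> * norm (F z) \<le> S * norm z ^ d" by (simp only: mult_le_cancel_right_pos)
    then have "norm (F z) \<le> S / \<epsilon> * norm z ^ d" using \<epsilon>(1) by (simp add: field_simps)
    also have "\<dots> \<le> (1 + S / \<epsilon>) * norm z ^ d" by (intro mult_right_mono) auto
    finally show ?thesis .
  qed
  define Q where "Q = (\<Sum>k\<le>d. monom ((deriv ^^ k) F 0 / fact k) k)"
  have "F = poly Q"
  proof
    fix z
    show "F z = poly Q z"
      using Liouville_polynomial[OF hol, of "max 1 r" "1 + S / \<epsilon>" d z] growth
      by (simp add: Q_def poly_sum poly_monom)
  qed
  moreover have "eval_fps (fps_of_poly Q) = poly Q" by (rule ext) simp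
  moreover have "eval_fps H has_fps_expansion H"
    by (rule eval_fps_has_fps_expansion) (simp add: entire)
  moreover have "eval_fps (fps_of_poly Q) has_fps_expansion fps_of_poly Q"
    by (rule eval_fps_has_fps_expansion) simp
  ultimately have "H = fps_of_poly Q"
    unfolding F_def by (metis fps_expansion_unique_complex)
  then have "fps_nth H n = coeff Q n" by simp
  also have "\<dots> = 0" using n by (simp add: Q_def coeff_sum)
  finally show ?thesis .
qed

section \<open>Taylor expansion along the flow\<close>

definition value_at :: "complex \<Rightarrow> complex \<Rightarrow> cpoly2 \<Rightarrow> complex" where
  "value_at x1 x2 g = poly (poly g [:x2:]) x1"

lemma ring_morphism_value_at: "ring_morphism (value_at x1 x2)"
  by unfold_locales (simp_all add: value_at_def)

lemma value_at_const2: "value_at x1 x2 (const2 c) = c"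
  by (simp add: value_at_def const2_def)

lemma value_at_eq_0D:
  assumes "\<And>x1 x2. value_at x1 x2 g = 0"
  shows "g = 0"
proof (rule ccontr)
  assume "g \<noteq> 0"
  then have "finite {p. poly g p = 0}" by (rule poly_roots_finite)
  moreover have "range (\<lambda>x. [:x:]) \<subseteq> {p. poly g p = 0}"
    using assms by (auto simp: value_at_def simp flip: poly_all_0_iff_0)
  ultimately have "finite (range (\<lambda>x::complex. [:x:]))" by (rule rev_finite_subset)
  moreover have "inj (\<lambda>x::complex. [:x:])" by (rule injI) simp
  ultimately show False using finite_imageD infinite_UNIV_char_0 by blast
qed

context slice_derivation
begin

text \<open>
  The Taylor series at time 0 of \<open>g\<close> along the trajectory of the vector field \<open>D\<close> that starts at the
  point \<open>(x1, x2)\<close>.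
\<close>
definition flow :: "complex \<Rightarrow> complex \<Rightarrow> cpoly2 \<Rightarrow> complex fps" where
  "flow x1 x2 g = Abs_fps (\<lambda>m. value_at x1 x2 ((D ^^ m) g) / fact m)"

lemma fps_deriv_flow: "fps_deriv (flow x1 x2 g) = flow x1 x2 (D g)"
  by (rule fps_ext) (simp add: flow_def field_simps funpow_swap1 del: of_nat_Suc)

lemma fps_deriv_funpow_flow: "(fps_deriv ^^ i) (flow x1 x2 g) = flow x1 x2 ((D ^^ i) g)"
  by (induction i) (simp_all add: fps_deriv_flow)

lemma D_funpow_zero: "(D ^^ n) 0 = 0"
  by (induction n) (simp_all add: D.zero)

lemma D_funpow_add: "(D ^^ n) (g + h) = (D ^^ n) g + (D ^^ n) h"
  by (induction n) (simp_all add: D.add)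

lemma flow_const2: "flow x1 x2 (const2 c) = fps_const c"
proof (rule fps_ext)
  fix n
  show "fps_nth (flow x1 x2 (const2 c)) n = fps_nth (fps_const c) n"
  proof (cases n)
    case (Suc m)
    then have "(D ^^ n) (const2 c) = 0"
      by (simp add: funpow_Suc_right derivation2_const2[OF derivation2] D_funpow_zero del: funpow.simps)
    with Suc show ?thesis by (simp add: flow_def value_at_def)
  qed (simp add: flow_def value_at_const2)
qed

lemma flow_add: "flow x1 x2 (g + h) = flow x1 x2 g + flow x1 x2 h"
proof -
  interpret v: ring_morphism "value_at x1 x2" by (rule ring_morphism_value_at)
  show ?thesis by (rule fps_ext) (simp add: flow_def D_funpow_add v.add add_divide_distrib)
qed

text \<open>
  By induction on the index of the coefficient, for all \<open>g\<close> and \<open>h\<close> at once: the Leibniz rule turns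
  the time derivative of either side into the sum of that side for \<open>(g, D h)\<close> and for \<open>(D g, h)\<close>.
\<close>
lemma flow_mult: "flow x1 x2 (g * h) = flow x1 x2 g * flow x1 x2 h"
proof (rule fps_ext)
  interpret v: ring_morphism "value_at x1 x2" by (rule ring_morphism_value_at)
  fix n
  show "fps_nth (flow x1 x2 (g * h)) n = fps_nth (flow x1 x2 g * flow x1 x2 h) n"
  proof (induction n arbitrary: g h)
    case 0
    show ?case by (simp add: flow_def v.mult)
  next
    case (Suc n)
    have "of_nat (Suc n) * fps_nth (flow x1 x2 (g * h)) (Suc n) = fps_nth (fps_deriv (flow x1 x2 (g * h))) n"
      by (simp only: fps_deriv_nth Suc_eq_plus1)
    also have "\<dots> = fps_nth (fps_deriv (flow x1 x2 g * flow x1 x2 h)) n"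
      by (simp only: fps_deriv_flow D.mult flow_add fps_add_nth Suc.IH fps_deriv_mult)
    also have "\<dots> = of_nat (Suc n) * fps_nth (flow x1 x2 g * flow x1 x2 h) (Suc n)"
      by (simp only: fps_deriv_nth Suc_eq_plus1)
    finally show ?case by (simp only: mult_cancel_left of_nat_eq_0_iff) simp
  qed
qed

lemma ring_morphism_flow: "ring_morphism (flow x1 x2)"
proof
  show "flow x1 x2 1 = 1"
    using flow_const2[of x1 x2 1] by (simp add: const2_hom)
qed (rule flow_add flow_mult)+

text \<open>
  The polynomial \<open>Q(f(p), s(p) + t)\<close> in the time \<open>t\<close>, for \<open>p = (x1, x2)\<close>: along a trajectory \<open>f\<close> is
  constant and \<open>s\<close> is time up to a shift.
\<close>
definition base_at :: "complex \<Rightarrow> complex \<Rightarrow> cpoly2 \<Rightarrow> complex poly" where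
  "base_at x1 x2 Q = pcompose (map_poly (\<lambda>q. poly q (value_at x1 x2 f)) Q) [:value_at x1 x2 s, 1:]"

lemma flow_\<sigma>: "flow x1 x2 (\<sigma> Q) = fps_of_poly (base_at x1 x2 Q)"
proof -
  define c where "c = value_at x1 x2 f"
  define t where "t = value_at x1 x2 s"
  interpret k: ring_morphism "\<lambda>q. [:poly q c:]"
    by unfold_locales (simp_all add: one_pCons)
  define b where "b = (\<lambda>Q. poly (map_poly (\<lambda>q. [:poly q c:]) Q) [:t, 1:])"
  interpret b: ring_morphism b unfolding b_def by (rule k.ring_morphism_poly)
  interpret v: ring_morphism "value_at x1 x2" by (rule ring_morphism_value_at)
  interpret fl: ring_morphism "flow x1 x2" by (rule ring_morphism_flow)
  have base: "base_at x1 x2 Q = b Q" for Q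
    by (simp add: base_at_def b_def c_def t_def pcompose_altdef map_poly_map_poly o_def)
  have flow_s: "flow x1 x2 s = fps_of_poly [:t, 1:]"
  proof (rule fps_ext)
    fix n
    have "(D ^^ Suc (Suc m)) s = 0" for m
      by (simp add: funpow_Suc_right D_s D.one D_funpow_zero del: funpow.simps)
    then have "fps_nth (flow x1 x2 s) (Suc (Suc m)) = 0" for m
      by (simp add: flow_def v.zero del: funpow.simps)
    then show "fps_nth (flow x1 x2 s) n = fps_nth (fps_of_poly [:t, 1:]) n"
      by (cases n; cases "n - 1") (auto simp: flow_def t_def D_s v.one)
  qed
  have flow_f: "flow x1 x2 f = fps_const c"
  proof (rule fps_ext)
    fix n
    have "(D ^^ Suc m) f = 0" for m
      by (simp add: funpow_Suc_right D_f D_funpow_zero del: funpow.simps)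
    then have "fps_nth (flow x1 x2 f) (Suc m) = 0" for m
      by (simp add: flow_def v.zero del: funpow.simps)
    then show "fps_nth (flow x1 x2 f) n = fps_nth (fps_const c) n"
      by (cases n) (auto simp: flow_def c_def)
  qed
  have "flow x1 x2 (\<sigma> Q) = fps_of_poly (b Q)"
  proof (induction Q rule: cpoly2_induct)
    case (const a)
    have "b (const2 a) = [:a:]" by (simp add: b_def const2_def map_poly_pCons)
    then show ?case by (simp add: subst2_generators flow_const2 fps_of_poly_const)
  next
    case X1
    have "b X1 = [:c:]" by (simp add: b_def X1_def map_poly_pCons)
    then show ?case by (simp add: subst2_generators flow_f fps_of_poly_const)
  next
    case X2
    have "b X2 = [:t, 1:]" by (simp add: b_def X2_def map_poly_pCons one_pCons)
    then show ?case by (simp add: subst2_generators flow_s)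
  next
    case (add P Q)
    then show ?case by (simp only: \<sigma>.add fl.add b.add fps_of_poly_add)
  next
    case (mult P Q)
    then show ?case by (simp only: \<sigma>.mult fl.mult b.mult fps_of_poly_mult)
  qed
  then show ?thesis by (simp add: base)
qed

lemma value_at_\<sigma>_inner: "value_at x1 x2 (\<sigma> [:q:]) = poly q (value_at x1 x2 f)"
proof -
  have "value_at x1 x2 (\<sigma> [:q:]) = fps_nth (flow x1 x2 (\<sigma> [:q:])) 0" by (simp add: flow_def)
  also have "\<dots> = poly q (value_at x1 x2 f)"
    by (simp add: flow_\<sigma> base_at_def map_poly_pCons pcompose_pCons)
  finally show ?thesis .
qed

lemma degree_base_at_le: "degree (base_at x1 x2 Q) \<le> degree Q"
proof -
  have "degree (base_at x1 x2 Q) = degree (map_poly (\<lambda>q. poly q (value_at x1 x2 f)) Q)"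
    by (simp add: base_at_def degree_pcompose)
  also have "\<dots> \<le> degree Q" by (rule map_poly_degree_leq)
  finally show ?thesis .
qed

lemma base_at_nonzero:
  assumes "poly (lead_coeff Q) (value_at x1 x2 f) \<noteq> 0"
  shows "base_at x1 x2 Q \<noteq> 0"
proof
  assume "base_at x1 x2 Q = 0"
  then have "map_poly (\<lambda>q. poly q (value_at x1 x2 f)) Q = 0"
    unfolding base_at_def by (rule pcompose_eq_0) simp
  then have "coeff (map_poly (\<lambda>q. poly q (value_at x1 x2 f)) Q) (degree Q) = 0" by simp
  with assms show False by (simp add: coeff_map_poly)
qed

text \<open>
  Let \<open>a(f)\<close> be the leading coefficient of the differential equation for \<open>g\<close>, and \<open>l(f)\<close> the
  coefficient of the highest power of \<open>s\<close> in the leading coefficient of an algebraic relation for \<open>g\<close>.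
  At a point where \<open>(a l)(f) \<noteq> 0\<close> both equations stay nondegenerate along the trajectory, so the
  Taylor series of \<open>g\<close> is entire and algebraic, hence a polynomial of degree at most \<open>d\<close>. Therefore
  \<open>(a l)(f) \<cdot> D\<^bsup>d+1\<^esup> g\<close> vanishes at every point.
\<close>
lemma locally_nilpotent_if_surj:
  assumes "surj D"
  obtains n where "(D ^^ n) g = 0"
proof -
  obtain N a c where ac: "a \<noteq> 0" "\<sigma> [:a:] * (D ^^ N) g = (\<Sum>i<N. \<sigma> (c i) * (D ^^ i) g)"
    using monic_differential_equation[OF assms] by blast
  obtain P where P: "P \<noteq> 0" "poly (map_poly \<sigma> P) g = 0" by (rule algebraic_relation)
  define l where "l = lead_coeff (lead_coeff P)"
  have l: "l \<noteq> 0" using P(1) by (simp add: l_def)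
  define d where "d = (\<Sum>k\<le>degree P. degree (coeff P k))"
  have deg: "degree (coeff P k) \<le> d" if "k \<le> degree P" for k
    unfolding d_def using that by (intro member_le_sum) auto
  have "\<sigma> [:a * l:] * (D ^^ Suc d) g = 0"
  proof (rule value_at_eq_0D)
    fix x1 x2
    interpret fl: ring_morphism "flow x1 x2" by (rule ring_morphism_flow)
    interpret v: ring_morphism "value_at x1 x2" by (rule ring_morphism_value_at)
    define z where "z = value_at x1 x2 f"
    show "value_at x1 x2 (\<sigma> [:a * l:] * (D ^^ Suc d) g) = 0"
    proof (cases "poly (a * l) z = 0")
      case True
      then show ?thesis by (simp only: v.mult value_at_\<sigma>_inner z_def mult_zero_left)
    next
      case False
      define H where "H = flow x1 x2 g"
      have base: "fps_of_poly (base_at x1 x2 [:a:]) = fps_const (poly a z)"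
        by (simp add: base_at_def map_poly_pCons pcompose_pCons z_def fps_of_poly_const)
      have "fps_const (poly a z) * (fps_deriv ^^ N) H = flow x1 x2 (\<sigma> [:a:] * (D ^^ N) g)"
        by (simp only: fl.mult H_def fps_deriv_funpow_flow flow_\<sigma> base)
      also have "\<dots> = (\<Sum>i<N. fps_of_poly (base_at x1 x2 (c i)) * (fps_deriv ^^ i) H)"
        by (simp only: ac(2) fl.sum fl.mult H_def fps_deriv_funpow_flow flow_\<sigma>)
      finally have ode: "fps_const (poly a z) * (fps_deriv ^^ N) H =
          (\<Sum>i<N. fps_of_poly (base_at x1 x2 (c i)) * (fps_deriv ^^ i) H)" .
      have "fps_conv_radius H = \<infinity>"
        by (rule entire_solution[OF _ ode]) (use False in auto)
      moreover have "(\<Sum>k\<le>degree P. fps_of_poly (base_at x1 x2 (coeff P k)) * H ^ k) = 0"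
      proof -
        have "(\<Sum>k\<le>degree P. \<sigma> (coeff P k) * g ^ k) = 0"
          using P(2) by (simp only: \<sigma>.poly_map_poly_altdef[OF order_refl])
        then have "flow x1 x2 (\<Sum>k\<le>degree P. \<sigma> (coeff P k) * g ^ k) = 0"
          by (simp only: fl.zero)
        then show ?thesis by (simp only: fl.sum fl.mult fl.power flow_\<sigma> H_def)
      qed
      moreover have "base_at x1 x2 (coeff P (degree P)) \<noteq> 0"
        using False by (intro base_at_nonzero) (simp add: l_def z_def)
      moreover have "degree (base_at x1 x2 (coeff P k)) \<le> d" if "k \<le> degree P" for k
        using degree_base_at_le deg[OF that] order.trans by blast
      ultimately have "fps_nth H (Suc d) = 0"
        by (rule entire_algebraic_imp_polynomial) simp_all
      then have "value_at x1 x2 ((D ^^ Suc d) g) = 0"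
        by (simp only: H_def flow_def fps_nth_Abs_fps divide_eq_0_iff fact_nonzero) simp
      then show ?thesis by (simp only: v.mult mult_zero_right)
    qed
  qed
  moreover have "\<sigma> [:a * l:] \<noteq> 0" using \<sigma>_inner_eq_0[of "a * l"] ac(1) l by auto
  ultimately have "(D ^^ Suc d) g = 0" by (simp only: mult_eq_0_iff) blast
  then show ?thesis by (rule that)
qed

end

section \<open>The kernel is a polynomial ring in one variable\<close>

text \<open>
  The total degree of the lexicographically leading monomial. It is additive on products, like the
  degree in the outer variable, but vanishes only on constants.
\<close>
definition size2 :: "cpoly2 \<Rightarrow> nat" where
  "size2 g = degree g + degree (lead_coeff g)"

lemma size2_mult: "g \<noteq> 0 \<Longrightarrow> h \<noteq> 0 \<Longrightarrow> size2 (g * h) = size2 g + size2 h"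
  unfolding size2_def lead_coeff_mult by (simp add: degree_mult_eq)

lemma size2_eq_0:
  assumes "size2 g = 0"
  shows "g \<in> range const2"
proof -
  from assms have "degree g = 0" by (simp add: size2_def)
  then obtain p where p: "g = [:p:]" by (rule degree_eq_zeroE)
  with assms have "degree p = 0" by (simp add: size2_def)
  then obtain c where "p = [:c:]" by (rule degree_eq_zeroE)
  with p show ?thesis by (auto simp: const2_def)
qed

lemma size2_diff_const2: "size2 (g - const2 c) \<le> size2 g"
proof (cases "degree g = 0")
  case True
  then obtain p where "g = [:p:]" by (rule degree_eq_zeroE)
  then show ?thesis by (simp add: size2_def const2_def) (intro degree_diff_le; simp)
next
  case False
  then have "degree (g - const2 c) = degree g"
    unfolding diff_conv_add_uminus by (intro degree_add_eq_left) (simp add: const2_def)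
  with False show ?thesis by (simp add: size2_def const2_def coeff_pCons split: nat.split)
qed

context slice_derivation
begin

text \<open>
  If \<open>D\<^sup>m g\<close> and \<open>D\<^sup>n h\<close> are the last nonzero iterates, then \<open>g\<close> and \<open>h\<close> have Taylor polynomials of
  degrees exactly \<open>m\<close> and \<open>n\<close> along a generic trajectory, and their product is constant there only
  if \<open>m = n = 0\<close>.
\<close>
lemma kernel_factorially_closed:
  assumes surj: "surj D" and gh: "D (g * h) = 0" "g * h \<noteq> 0"
  shows "D g = 0"
proof -
  have last: "\<exists>m. (D ^^ m) g \<noteq> 0 \<and> (\<forall>i>m. (D ^^ i) g = 0)" if "g \<noteq> 0" for g
  proof -
    obtain n where n: "(D ^^ n) g = 0" using locally_nilpotent_if_surj[OF surj] by blast
    define n0 where "n0 = (LEAST n. (D ^^ n) g = 0)"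
    have n0: "(D ^^ n0) g = 0" unfolding n0_def using n by (rule LeastI)
    with that have "n0 \<noteq> 0" by (cases n0) auto
    then obtain m where m: "n0 = Suc m" by (cases n0) auto
    have "(D ^^ m) g \<noteq> 0" using not_less_Least[of m "\<lambda>n. (D ^^ n) g = 0"] m by (simp add: n0_def)
    moreover have "(D ^^ i) g = 0" if "i > m" for i
    proof -
      have "(D ^^ (i - n0 + n0)) g = 0"
        by (simp only: funpow_add comp_apply n0 D_funpow_zero)
      moreover have "i - n0 + n0 = i" using that m by simp
      ultimately show ?thesis by simp
    qed
    ultimately show ?thesis by blast
  qed
  from gh(2) have "g \<noteq> 0" "h \<noteq> 0" by auto
  then obtain m n where m: "(D ^^ m) g \<noteq> 0" "\<And>i. i > m \<Longrightarrow> (D ^^ i) g = 0"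
    and n: "(D ^^ n) h \<noteq> 0" "\<And>i. i > n \<Longrightarrow> (D ^^ i) h = 0"
    using last[of g] last[of h] by blast
  have "(D ^^ m) g * (D ^^ n) h \<noteq> 0" using m n by simp
  then obtain x1 x2 where x: "value_at x1 x2 ((D ^^ m) g * (D ^^ n) h) \<noteq> 0"
    using value_at_eq_0D by blast
  interpret v: ring_morphism "value_at x1 x2" by (rule ring_morphism_value_at)
  have "fps_nth (flow x1 x2 (g * h)) (m + n) =
      (\<Sum>i=0..m+n. fps_nth (flow x1 x2 g) i * fps_nth (flow x1 x2 h) (m + n - i))"
    by (simp add: flow_mult fps_mult_nth)
  also have "\<dots> = (\<Sum>i\<in>{m}. fps_nth (flow x1 x2 g) i * fps_nth (flow x1 x2 h) (m + n - i))"
  proof (rule sum.mono_neutral_right)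
    show "\<forall>i\<in>{0..m + n} - {m}. fps_nth (flow x1 x2 g) i * fps_nth (flow x1 x2 h) (m + n - i) = 0"
    proof
      fix i assume "i \<in> {0..m + n} - {m}"
      then have "i > m \<or> m + n - i > n" by auto
      then show "fps_nth (flow x1 x2 g) i * fps_nth (flow x1 x2 h) (m + n - i) = 0"
        using m(2) n(2) by (auto simp: flow_def v.zero)
    qed
  qed auto
  also have "\<dots> \<noteq> 0" using x by (simp add: flow_def v.mult)
  finally have "(D ^^ (m + n)) (g * h) \<noteq> 0" by (auto simp: flow_def v.zero)
  moreover have "(D ^^ Suc k) (g * h) = 0" for k
    by (simp only: funpow_Suc_right comp_apply gh(1) D_funpow_zero)
  ultimately have "m + n \<noteq> Suc k" for k by metis
  then have "m = 0" by (cases "m + n") auto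
  with m(2)[of 1] show ?thesis by simp
qed

text \<open>
  \<open>D\<close> acts on polynomials in \<open>s\<close> over the kernel as differentiation, which lowers the degree of a relation.
\<close>
lemma s_transcendental_over_kernel:
  assumes "\<And>k. D (coeff p k) = 0" "poly p s = 0"
  shows "p = 0"
  using assms
proof (induction "degree p" arbitrary: p rule: less_induct)
  case less
  have D_poly: "D (poly q s) = poly (pderiv q) s" if "\<And>k. D (coeff q k) = 0" for q
    using that
  proof (induction q)
    case 0
    show ?case by (simp add: D.zero)
  next
    case (pCons a q)
    from pCons.prems[of 0] have "D a = 0" by simp
    moreover have "D (coeff q k) = 0" for k using pCons.prems[of "Suc k"] by simp
    then have "D (poly q s) = poly (pderiv q) s" by (rule pCons.IH)
    ultimately show ?case by (simp add: D.add D.mult D_s pderiv_pCons algebra_simps)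
  qed
  have "degree p = 0"
  proof (rule ccontr)
    assume deg: "degree p \<noteq> 0"
    have "D (coeff (pderiv p) k) = 0" for k
    proof -
      have "D (of_nat (Suc k)) = 0"
        using D.sum[of "\<lambda>_. 1" "{..k}"] by (simp add: D.one)
      then show ?thesis by (simp add: coeff_pderiv D.mult less.prems(1) del: of_nat_Suc)
    qed
    moreover have "poly (pderiv p) s = 0"
      using D_poly[OF less.prems(1)] less.prems(2) by (simp add: D.zero)
    ultimately have "pderiv p = 0"
      using deg by (intro less.hyps) (simp_all add: degree_pderiv)
    with deg show False by (simp add: pderiv_eq_0_iff)
  qed
  then obtain a where "p = [:a:]" by (rule degree_eq_zeroE)
  with less.prems(2) show ?case by simp
qed

text \<open>
  A nonconstant kernel element \<open>y\<close> of least size is irreducible, since its factors lie in the kernel,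
  and so it is prime. Given another kernel element \<open>h\<close>, a relation between \<open>h\<close> and \<open>y\<close> in which
  superfluous factors \<open>y\<close> are cancelled shows that \<open>y\<close> divides \<open>a(h)\<close> for some nonzero polynomial \<open>a\<close>
  over \<open>\<complex>\<close>. It then divides a linear factor \<open>h - b\<close>, and the quotient is a kernel element of smaller
  size.
\<close>
lemma kernel_generator:
  assumes surj: "surj D"
  shows "\<exists>y. D y = 0 \<and> (\<forall>h. D h = 0 \<longrightarrow> (\<exists>q. h = poly (map_poly const2 q) y))"
proof -
  interpret c: ring_morphism const2 by (rule ring_morphism_const2)
  define K where "K = {g. D g = 0 \<and> g \<notin> range const2}"
  have "f \<in> K" using D_f f_nonconst by (simp add: K_def)
  then obtain y where y: "y \<in> K" and y_min: "\<And>g. g \<in> K \<Longrightarrow> size2 y \<le> size2 g"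
    using ex_has_least_nat[of "\<lambda>g. g \<in> K" f size2] by blast
  have Dy: "D y = 0" and y_nonconst: "y \<notin> range const2" using y by (simp_all add: K_def)
  have y0: "y \<noteq> 0" using y_nonconst const2_hom(1) by (metis rangeI)
  have size_y: "size2 y > 0" using y_nonconst size2_eq_0 by blast
  have unit_const2: "is_unit (const2 a)" if "a \<noteq> 0" for a
  proof -
    have "const2 a * const2 (inverse a) = 1"
      using that by (simp only: c.mult[symmetric] right_inverse c.one not_False_eq_True simp_thms)
    then show ?thesis by (metis dvd_triv_left)
  qed
  have y_not_unit: "\<not> is_unit y"
  proof
    assume "is_unit y"
    then obtain z where z: "1 = y * z" by (elim dvdE)
    then have "z \<noteq> 0" by auto
    have "size2 (y * z) = 0" by (simp add: size2_def flip: z)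
    with size2_mult[OF y0 \<open>z \<noteq> 0\<close>] size_y show False by simp
  qed
  have "irreducible y"
  proof (rule irreducibleI[OF y0 y_not_unit])
    fix u v assume uv: "y = u * v"
    with y0 have nz: "u \<noteq> 0" "v \<noteq> 0" by auto
    have "D u = 0" "D v = 0"
      using kernel_factorially_closed[OF surj, of u v] kernel_factorially_closed[OF surj, of v u]
        Dy y0 uv by (simp_all add: mult.commute)
    show "is_unit u \<or> is_unit v"
    proof (cases "u \<in> range const2")
      case True
      then obtain a where "u = const2 a" by auto
      moreover from this nz have "a \<noteq> 0" by (auto simp: const2_hom)
      ultimately show ?thesis using unit_const2 by blast
    next
      case False
      with \<open>D u = 0\<close> have "size2 y \<le> size2 u" by (intro y_min) (simp add: K_def)
      with size2_mult[OF nz] uv have "size2 v = 0" by simp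
      then obtain a where "v = const2 a" using size2_eq_0 by auto
      moreover from this nz have "a \<noteq> 0" by (auto simp: const2_hom)
      ultimately show ?thesis using unit_const2 by blast
    qed
  qed
  then have prime: "prime_elem y" by (rule irreducible_imp_prime_elem)
  have root: "\<exists>b. y dvd h - const2 b" if "a \<noteq> 0" "y dvd poly (map_poly const2 a) h" for a h
    using that
  proof (induction "degree a" arbitrary: a rule: less_induct)
    case less
    interpret \<rho>: ring_morphism "\<lambda>p. poly (map_poly const2 p) h" by (rule c.ring_morphism_poly)
    show ?case
    proof (cases "degree a = 0")
      case True
      then obtain b where "a = [:b:]" by (rule degree_eq_zeroE)
      with less.prems have "b \<noteq> 0" "y dvd const2 b" by (simp_all add: map_poly_pCons const2_def)
      with unit_const2 y_not_unit dvd_trans show ?thesis by blast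
    next
      case False
      then obtain r where "poly a r = 0"
        using Fundamental_Theorem_Algebra.fundamental_theorem_of_algebra[of a] by (auto simp: constant_degree)
      then obtain q where q: "a = [:- r, 1:] * q" by (auto simp: poly_eq_0_iff_dvd elim: dvdE)
      have "poly (map_poly const2 [:- r, 1:]) h = h - const2 r"
        by (simp only: c.poly_map_poly_pCons c.minus c.one map_poly_0 poly_0) simp
      with less.prems(2) have "y dvd (h - const2 r) * poly (map_poly const2 q) h"
        unfolding q \<rho>.mult by simp
      then consider "y dvd h - const2 r" | "y dvd poly (map_poly const2 q) h"
        using prime prime_elem_dvd_mult_iff by blast
      then show ?thesis
      proof cases
        case 2
        have "q \<noteq> 0" using q less.prems(1) by auto
        moreover from this have "degree q < degree a"
          unfolding q by (simp add: degree_mult_eq del: mult_pCons_left)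
        ultimately show ?thesis using less.hyps 2 by blast
      qed blast
    qed
  qed
  have "\<exists>q. h = poly (map_poly const2 q) y" if "D h = 0" for h
    using that
  proof (induction "size2 h" arbitrary: h rule: less_induct)
    case less
    show ?case
    proof (cases "h \<in> range const2")
      case True
      then obtain b where "h = const2 b" by auto
      then have "h = poly (map_poly const2 [:b:]) y" by (simp add: c.poly_map_poly_pCons)
      then show ?thesis ..
    next
      case False
      interpret t: ring_morphism "subst2 h y" by (rule ring_morphism_subst2)
      obtain P where P: "P \<noteq> 0" "poly (map_poly (subst2 h y) P) s = 0" by (rule algebraic_relation)
      \<comment> \<open>\<open>P\<close> relates \<open>h, y\<close> and \<open>s\<close>; each of its coefficients as a polynomial in \<open>s\<close> must be a relation
        between \<open>h\<close> and \<open>y\<close>.\<close>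
      have "D (coeff (map_poly (subst2 h y) P) k) = 0" for k
        by (simp add: coeff_map_poly t.zero derivation2_subst2[OF derivation2] Dy less.prems)
      then have "map_poly (subst2 h y) P = 0" using P(2) by (rule s_transcendental_over_kernel)
      then have "subst2 h y (coeff P k) = 0" for k by (metis coeff_0 coeff_map_poly t.zero)
      moreover obtain k where "coeff P k \<noteq> 0" using P(1) by (metis leading_coeff_0_iff)
      ultimately obtain Q where Q: "Q \<noteq> 0" "subst2 h y Q = 0" by blast
      have "\<exists>a. a \<noteq> 0 \<and> y dvd poly (map_poly const2 a) h"
        using Q
      proof (induction Q)
        case (pCons a Q)
        have "subst2 h y (pCons a Q) = poly (map_poly const2 a) h + y * subst2 h y Q"
          by (simp add: subst2_def map_poly_pCons)
        with pCons.prems have eq: "poly (map_poly const2 a) h + y * subst2 h y Q = 0" by simp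
        show ?case
        proof (cases "a = 0")
          case True
          with eq y0 pCons show ?thesis by simp
        next
          case False
          from eq have "poly (map_poly const2 a) h = y * (- subst2 h y Q)"
            by (simp add: eq_neg_iff_add_eq_0)
          with False show ?thesis by (metis dvd_triv_left)
        qed
      qed simp
      then obtain b where "y dvd h - const2 b" using root by blast
      then obtain h1 where h1: "h - const2 b = y * h1" by (elim dvdE)
      have nz: "h - const2 b \<noteq> 0" using False by auto
      have "D (y * h1) = 0"
        unfolding h1[symmetric] by (simp add: D.diff less.prems derivation2_const2[OF derivation2])
      then have "D h1 = 0"
        using kernel_factorially_closed[OF surj, of h1 y] nz h1 by (simp add: mult.commute)
      moreover have "size2 h1 < size2 h"
        using size2_mult[of y h1] size2_diff_const2[of h b] size_y nz h1 y0 by auto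
      ultimately obtain q where "h1 = poly (map_poly const2 q) y" using less.hyps by blast
      then have "h = poly (map_poly const2 (pCons b q)) y"
        using h1 by (simp add: c.poly_map_poly_pCons algebra_simps)
      then show ?thesis ..
    qed
  qed
  with Dy show ?thesis by blast
qed

text \<open>
  Integration with respect to \<open>s\<close> shows by induction that every element killed by a power of \<open>D\<close> is a
  polynomial in \<open>s\<close> and \<open>y\<close>: if \<open>D g\<close> is one, then it has an antiderivative of this form, which
  differs from \<open>g\<close> by a kernel element.
\<close>
lemma is_partial1_if_surj:
  assumes surj: "surj D"
  shows "\<exists>y1 y2. adjoin2 y1 y2 = UNIV \<and> D = partial1 y1 y2"
proof -
  obtain y where y: "D y = 0" "\<And>h. D h = 0 \<Longrightarrow> \<exists>q. h = poly (map_poly const2 q) y"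
    using kernel_generator[OF surj] by blast
  interpret t: ring_morphism "subst2 s y" by (rule ring_morphism_subst2)
  have D_subst: "D (subst2 s y P) = subst2 s y (partial_X1 P)" for P
    using derivation2_subst2[OF derivation2, of s y P] by (simp add: D_s y(1))
  have ker: "h \<in> adjoin2 s y" if Dh: "D h = 0" for h
  proof -
    obtain q where q: "h = poly (map_poly const2 q) y" using y(2)[OF Dh] by blast
    have "subst2 s y (map_poly (\<lambda>c. [:c:]) q) = h"
      by (simp add: q subst2_def map_poly_map_poly o_def map_poly_pCons const2_hom(1))
    then show ?thesis unfolding adjoin2_def by (metis rangeI)
  qed
  have "g \<in> adjoin2 s y" if "(D ^^ n) g = 0" for n g
    using that
  proof (induction n arbitrary: g)
    case 0
    then show ?case using ker[of g] by (simp add: D.zero)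
  next
    case (Suc n)
    then have "D g \<in> adjoin2 s y" by (simp add: funpow_swap1)
    then obtain P where P: "D g = subst2 s y P" by (auto simp: adjoin2_def)
    obtain Q where Q: "P = partial_X1 Q" using surjD[OF surj_partial_X1, of P] by auto
    have "D (g - subst2 s y Q) = 0" by (simp add: D.diff P Q D_subst)
    then obtain R where "g - subst2 s y Q = subst2 s y R" using ker by (auto simp: adjoin2_def)
    then have "g = subst2 s y (R + Q)" by (simp add: t.add algebra_simps)
    then show ?case unfolding adjoin2_def by blast
  qed
  then have gen: "adjoin2 s y = UNIV" using locally_nilpotent_if_surj[OF surj] by (metis UNIV_eq_I)
  have "D g = partial1 s y g" for g
  proof -
    obtain P where "g = subst2 s y P" using gen unfolding adjoin2_def by auto
    then show ?thesis by (simp add: D_subst partial1_subst2[OF subst2_inj_if_generates[OF gen]])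
  qed
  with gen show ?thesis by blast
qed

end

theorem theorem1:
  fixes D :: "cpoly2 \<Rightarrow> cpoly2"
  assumes "derivation2 D"
  shows "(\<exists>y1 y2. adjoin2 y1 y2 = UNIV \<and> D = partial1 y1 y2) \<longleftrightarrow>
         surj D \<and> range const2 \<subset> ker2 D"
proof
  assume "\<exists>y1 y2. adjoin2 y1 y2 = UNIV \<and> D = partial1 y1 y2"
  then show "surj D \<and> range const2 \<subset> ker2 D"
    using surj_and_kernel_if_partial1 assms by blast
next
  assume D: "surj D \<and> range const2 \<subset> ker2 D"
  then obtain f where f: "D f = 0" "f \<notin> range const2" by (auto simp: ker2_def)
  obtain s where s: "D s = 1" using surjD[of D 1] D by auto
  interpret slice_derivation D f s
    using assms f s by unfold_locales
  show "\<exists>y1 y2. adjoin2 y1 y2 = UNIV \<and> D = partial1 y1 y2"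
    using D by (intro is_partial1_if_surj) blast
qed

end
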